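(* Assume that for some $T>0$ and $s>5/2$, $u\in C([0,T];H^s)$ is a strong solution of the initial value problem associated to the equation $$u_t+u^2u_x+\partial_xG*\Big(\frac23u^3+uu_x^2\Big)+\frac13\partial_x^2G*u_x^3=0,\qquad x\in\mathbb{R}.$$ If $u_0(x)=u(0,x)$ satisfies, for some $\beta\in(\frac13,1)$, $$|u_0(x)|= O(e^{-x}),\qquad |\partial_xu_0(x)|= O(e^{-\beta x})\quad\text{as }x\to+\infty,$$ then $$|u(t,x)|= O(e^{-x})\quad\text{as }x\to+\infty,$$ uniformly in the time interval $[0,T]$.
   Context: $G(x)=\frac12e^{-|x|}$, so that $G*f=(1-\partial_x^2)^{-1}f$; $*$ is convolution in $x$ over $\mathbb{R}$, and $H^s=H^s(\mathbb{R})$. The displayed equation is equivalent to $m_t+(u^2-u_x^2)m_x+2u_xm^2=0$ with $m=u-u_{xx}$. "Uniformly in $[0,T]$" means that the constants in the $O(\cdot)$ bound can be chosen independently of $t\in[0,T]$. *)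

theory Defs
  imports "HOL-Analysis.Analysis" "HOL-Library.Landau_Symbols"
begin

definition square_integrable :: "(real \<Rightarrow> complex) \<Rightarrow> bool" where
  "square_integrable f \<longleftrightarrow>
     f \<in> borel_measurable lborel \<and> integrable lborel (\<lambda>x. (cmod (f x))\<^sup>2)"

text \<open>Fourier transform of the restriction of \<open>f\<close> to the interval from \<open>-n\<close> to \<open>n\<close>,
  normalised as the integral of \<open>exp (- \<i> * \<xi> * x) * f x\<close>.\<close>

definition truncated_fourier :: "nat \<Rightarrow> (real \<Rightarrow> complex) \<Rightarrow> real \<Rightarrow> complex" where
  "truncated_fourier n f \<xi> =
     (LINT x:{- real n..real n}|lborel. cis (- (\<xi> * x)) * f x)"

text \<open>The Fourier--Plancherel transform on \<open>L\<^sup>2\<close>: the \<open>L\<^sup>2\<close>-limit of the truncated transforms.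
  It is determined up to a null set.\<close>

definition has_fourier_transform :: "(real \<Rightarrow> complex) \<Rightarrow> (real \<Rightarrow> complex) \<Rightarrow> bool" where
  "has_fourier_transform f F \<longleftrightarrow>
     square_integrable f \<and> square_integrable F \<and>
     (\<lambda>n. \<integral>\<^sup>+ \<xi>. ennreal ((cmod (truncated_fourier n f \<xi> - F \<xi>))\<^sup>2) \<partial>lborel)
       \<longlonglongrightarrow> 0"

definition fourier :: "(real \<Rightarrow> complex) \<Rightarrow> real \<Rightarrow> complex" where
  "fourier f = (SOME F. has_fourier_transform f F)"

text \<open>Real-valued functions representing an element of \<open>H\<^sup>s(\<real>)\<close>, for \<open>s \<ge> 0\<close>.\<close>

definition Hs :: "real \<Rightarrow> (real \<Rightarrow> real) set" where
  "Hs s = {f. square_integrable (\<lambda>x. complex_of_real (f x)) \<and>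
     (\<exists>F. has_fourier_transform (\<lambda>x. complex_of_real (f x)) F \<and>
          integrable lborel (\<lambda>\<xi>. (1 + \<xi>\<^sup>2) powr s * (cmod (F \<xi>))\<^sup>2))}"

text \<open>Meaningful only for \<open>f \<in> Hs s\<close>; it does not depend on the choice made in
  \<^const>\<open>fourier\<close>.\<close>

definition Hs_norm :: "real \<Rightarrow> (real \<Rightarrow> real) \<Rightarrow> real" where
  "Hs_norm s f =
     sqrt (LINT \<xi>|lborel. (1 + \<xi>\<^sup>2) powr s * (cmod (fourier (\<lambda>x. complex_of_real (f x)) \<xi>))\<^sup>2)"

definition continuous_into_Hs :: "real \<Rightarrow> real set \<Rightarrow> (real \<Rightarrow> real \<Rightarrow> real) \<Rightarrow> bool" where
  "continuous_into_Hs s I u \<longleftrightarrow>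
     (\<forall>t\<in>I. u t \<in> Hs s) \<and>
     (\<forall>t\<in>I. ((\<lambda>\<tau>. Hs_norm s (\<lambda>x. u \<tau> x - u t x)) \<longlongrightarrow> 0) (at t within I))"

definition has_Hs_derivative ::
    "real \<Rightarrow> real set \<Rightarrow> (real \<Rightarrow> real \<Rightarrow> real) \<Rightarrow> (real \<Rightarrow> real) \<Rightarrow> real \<Rightarrow> bool" where
  "has_Hs_derivative s I u v t \<longleftrightarrow>
     (\<forall>\<tau>\<in>I. u \<tau> \<in> Hs s) \<and> v \<in> Hs s \<and>
     ((\<lambda>\<tau>. Hs_norm s (\<lambda>x. (u \<tau> x - u t x) / (\<tau> - t) - v x)) \<longlongrightarrow> 0) (at t within I)"

definition G :: "real \<Rightarrow> real" where
  "G x = exp (- \<bar>x\<bar>) / 2"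

definition convolution :: "(real \<Rightarrow> real) \<Rightarrow> (real \<Rightarrow> real) \<Rightarrow> real \<Rightarrow> real" where
  "convolution f g x = (LINT y|lborel. f (x - y) * g y)"

text \<open>Strong solutions in \<open>C([0,T]; H\<^sup>s)\<close>. An element of \<open>H\<^sup>s\<close> with \<open>s > 5/2\<close> is a class of
  functions modulo null sets containing exactly one continuous function, which is twice
  continuously differentiable; \<open>u t\<close> is that function, so \<^const>\<open>deriv\<close> is the classical
  derivative. The time derivative is taken in \<open>H\<^bsup>s-1\<^esup>\<close>; by the equation it
  is then automatically continuous in time, so that \<open>u\<close> is also in \<open>C\<^sup>1([0,T]; H\<^bsup>s-1\<^esup>)\<close>.
  The terms \<open>\<partial>\<^sub>xG * f\<close> and \<open>\<partial>\<^sub>x\<^sup>2G * f\<close> are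
  read as derivatives of \<open>G * f\<close>, since the second derivative of \<open>G\<close> is not a function.\<close>

definition strong_solution :: "real \<Rightarrow> real \<Rightarrow> (real \<Rightarrow> real \<Rightarrow> real) \<Rightarrow> bool" where
  "strong_solution s T u \<longleftrightarrow>
     continuous_into_Hs s {0..T} u \<and>
     (\<forall>t\<in>{0..T}. continuous_on UNIV (u t)) \<and>
     (\<exists>u'. \<forall>t\<in>{0..T}.
        has_Hs_derivative (s - 1) {0..T} u (u' t) t \<and>
        (\<forall>x. u' t x + (u t x)\<^sup>2 * deriv (u t) x
             + deriv (convolution G (\<lambda>y. 2/3 * (u t y)^3 + u t y * (deriv (u t) y)\<^sup>2)) x
             + 1/3 * deriv (deriv (convolution G (\<lambda>y. (deriv (u t) y)^3))) x = 0))"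

end

theory Submission
  imports "HOL-Probability.Characteristic_Functions" "HOL-Real_Asymp.Real_Asymp" Defs
begin

text \<open>
  Since \<open>\<partial>\<^sub>x\<^sup>2G * g = G * g - g\<close>, both \<open>u\<close> and \<open>w = u\<^sub>x\<close> are transported with the bounded speed
  \<open>u\<^sup>2 - w\<^sup>2\<close>, up to cubic source terms and their convolutions with \<open>G\<close> and \<open>G'\<close>, where \<open>\<bar>G'\<bar> = G\<close>.
  Let \<open>\<sigma> x = exp (- \<beta> * x) + \<epsilon> * exp (\<beta> * x)\<close>. For \<open>\<beta> < 1\<close> convolution with \<open>G\<close> maps functions bounded by \<open>\<sigma>\<close>
  to functions bounded by a multiple of \<open>\<sigma>\<close>, uniformly in \<open>\<epsilon>\<close>, and \<open>(u\<^sup>2 + w\<^sup>2) / \<sigma>\<^sup>2\<close> vanishes at infinity.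
  Evaluating the equations at a maximum point of \<open>exp (- L * t) * (u\<^sup>2 + w\<^sup>2) / \<sigma>\<^sup>2\<close> shows that for large \<open>L\<close>
  the maximum lies at time \<open>0\<close>; letting \<open>\<epsilon>\<close> tend to \<open>0\<close> gives \<open>u, w = O(exp (- \<beta> * x))\<close> uniformly in time.
  The source terms are then \<open>O(exp (- 3 * \<beta> * x))\<close> with \<open>3 * \<beta> > 1\<close>, and since \<open>exp (- \<bar>x - y\<bar>) \<le> exp (- x) * exp y\<close>
  the time derivative of \<open>u\<close> is \<open>O(exp (- x))\<close>; it remains to integrate in time.

  The classical regularity used here follows from Sobolev embedding, which rests on the inversion formula
  for continuous functions with integrable Fourier--Plancherel transform. That formula is obtained by testing
  the transform against modulated Gaussians, so Plancherel's theorem itself is not needed.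
\<close>

section \<open>Fourier inversion\<close>

lemma square_integrable_mult_integrable:
  assumes "square_integrable f" "square_integrable g"
  shows "integrable lborel (\<lambda>x. f x * g x)"
proof (rule Bochner_Integration.integrable_bound[where f = "\<lambda>x. (cmod (f x))\<^sup>2 + (cmod (g x))\<^sup>2"])
  show "integrable lborel (\<lambda>x. (cmod (f x))\<^sup>2 + (cmod (g x))\<^sup>2)"
    using assms unfolding square_integrable_def by (intro Bochner_Integration.integrable_add) auto
  show "(\<lambda>x. f x * g x) \<in> borel_measurable lborel"
    using assms unfolding square_integrable_def by (intro borel_measurable_times) auto
  have "a * b \<le> a\<^sup>2 + b\<^sup>2" if "0 \<le> a" "0 \<le> b" for a b :: real
    using sum_squares_bound[of a b] mult_nonneg_nonneg[OF that] by linarith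
  then show "AE x in lborel. norm (f x * g x) \<le> norm ((cmod (f x))\<^sup>2 + (cmod (g x))\<^sup>2)"
    by (auto simp: norm_mult)
qed

lemma cmod_add_square_le: "(cmod (p + q))\<^sup>2 \<le> 2 * (cmod p)\<^sup>2 + 2 * (cmod q)\<^sup>2"
proof -
  have "(cmod (p + q))\<^sup>2 \<le> (cmod p + cmod q)\<^sup>2"
    by (intro power_mono norm_triangle_ineq) auto
  also have "\<dots> \<le> 2 * (cmod p)\<^sup>2 + 2 * (cmod q)\<^sup>2"
    using sum_squares_bound[of "cmod p" "cmod q"] by (simp add: power2_sum)
  finally show ?thesis .
qed

lemma square_integrable_linear:
  assumes "square_integrable f" "square_integrable g"
  shows "square_integrable (\<lambda>x. a * f x + b * g x)"
  unfolding square_integrable_def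
proof
  show [measurable]: "(\<lambda>x. a * f x + b * g x) \<in> borel_measurable lborel"
    using assms by (auto simp: square_integrable_def)
  have "(cmod (a * f x + b * g x))\<^sup>2 \<le> 2 * (cmod a)\<^sup>2 * (cmod (f x))\<^sup>2 + 2 * (cmod b)\<^sup>2 * (cmod (g x))\<^sup>2" for x
    using cmod_add_square_le[of "a * f x" "b * g x"] by (simp add: norm_mult power_mult_distrib)
  then have "norm ((cmod (a * f x + b * g x))\<^sup>2)
     \<le> norm (2 * (cmod a)\<^sup>2 * (cmod (f x))\<^sup>2 + 2 * (cmod b)\<^sup>2 * (cmod (g x))\<^sup>2)" for x
    by (smt (verit) real_norm_def zero_le_power2)
  then show "integrable lborel (\<lambda>x. (cmod (a * f x + b * g x))\<^sup>2)"
    using assms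
    by (intro Bochner_Integration.integrable_bound[where g = "\<lambda>x. (cmod (a * f x + b * g x))\<^sup>2"
       and f = "\<lambda>x. 2 * (cmod a)\<^sup>2 * (cmod (f x))\<^sup>2 + 2 * (cmod b)\<^sup>2 * (cmod (g x))\<^sup>2"])
      (simp_all add: square_integrable_def)
qed

lemma square_integrable_indicator:
  "square_integrable (\<lambda>x. indicator {a..b::real} x)"
proof -
  have "(cmod (indicator {a..b} x))\<^sup>2 = indicator {a..b} x" for x :: real
    by (auto simp: indicator_def)
  moreover have "integrable lborel (indicator {a..b} :: real \<Rightarrow> real)"
    by (rule integrable_real_indicator) (auto simp: emeasure_lborel_Icc_eq)
  ultimately show ?thesis
    by (simp add: square_integrable_def)
qed

text \<open>The indicator of a bounded interval is itself square integrable, so this is the product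
  estimate with the indicator as one factor.\<close>

lemma square_integrable_truncated:
  assumes "square_integrable f"
  shows "set_integrable lborel {a..b::real} f"
proof -
  have "indicator {a..b} x *\<^sub>R f x = indicator {a..b} x * f x" for x
    by (simp add: indicator_def)
  then show ?thesis
    using square_integrable_mult_integrable[OF square_integrable_indicator assms, of a b]
    unfolding set_integrable_def by presburger
qed

text \<open>Moving the indicator onto \<open>f\<close> gives an ordinary integral over the whole
  line, the shape in which linearity, measurability in \<open>\<xi>\<close> and Fubini
  apply.\<close>

lemma truncated_fourier_eq:
  "truncated_fourier n f \<xi> = (LINT x|lborel. cis (- (\<xi> * x)) * (indicator {- real n..real n} x *\<^sub>R f x))"
  unfolding truncated_fourier_def set_lebesgue_integral_def
  by (intro Bochner_Integration.integral_cong) (auto simp: indicator_def)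

lemma cis_measurable [measurable]: "cis \<in> borel_measurable borel"
  by (intro borel_measurable_continuous_onI continuous_intros)

lemma square_integrable_truncated_exp:
  assumes "square_integrable f"
  shows "integrable lborel (\<lambda>x. cis (- (\<xi> * x)) * (indicator {- real n..real n} x *\<^sub>R f x))"
proof (rule Bochner_Integration.integrable_bound)
  have [measurable]: "f \<in> borel_measurable borel"
    using assms by (simp add: square_integrable_def)
  show "integrable lborel (\<lambda>x. indicator {- real n..real n} x *\<^sub>R f x)"
    using square_integrable_truncated[OF assms, of "- real n" "real n"] by (simp only: set_integrable_def)
  show "(\<lambda>x. cis (- (\<xi> * x)) * (indicator {- real n..real n} x *\<^sub>R f x)) \<in> borel_measurable lborel"
    by measurable
qed (rule AE_I2, simp only: norm_mult norm_cis mult_1 order_refl)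

lemma truncated_fourier_linear:
  assumes "square_integrable f" "square_integrable g"
  shows "truncated_fourier n (\<lambda>x. a * f x + b * g x) \<xi>
     = a * truncated_fourier n f \<xi> + b * truncated_fourier n g \<xi>"
proof -
  have "truncated_fourier n (\<lambda>x. a * f x + b * g x) \<xi> =
    (LINT x|lborel. a * (cis (- (\<xi> * x)) * (indicator {- real n..real n} x *\<^sub>R f x))
        + b * (cis (- (\<xi> * x)) * (indicator {- real n..real n} x *\<^sub>R g x)))"
    unfolding truncated_fourier_eq
    by (intro Bochner_Integration.integral_cong) (auto simp: scaleR_conv_of_real algebra_simps)
  also have "\<dots> = a * truncated_fourier n f \<xi> + b * truncated_fourier n g \<xi>"
    unfolding truncated_fourier_eq
    by (subst Bochner_Integration.integral_add, (intro integrable_mult_right square_integrable_truncated_exp assms)+, subst (1 2) integral_mult_right_zero, rule refl)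
  finally show ?thesis .
qed

lemma truncated_fourier_measurable [measurable]:
  assumes "square_integrable f"
  shows "truncated_fourier n f \<in> borel_measurable lborel"
proof -
  have [measurable]: "f \<in> borel_measurable borel"
    using assms by (simp add: square_integrable_def)
  show ?thesis
    unfolding truncated_fourier_eq[abs_def] by measurable
qed

text \<open>The pointwise bound |f + g|^2 \<le> 2 |f|^2 + 2 |g|^2 takes the place of Minkowski's
  inequality: only convergence to zero matters below, so the factors 2 are harmless.\<close>

lemma nn_integral_cmod_add_square_le:
  fixes f g :: "real \<Rightarrow> complex"
  assumes [measurable]: "f \<in> borel_measurable lborel" "g \<in> borel_measurable lborel"
  shows "(\<integral>\<^sup>+ x. ennreal ((cmod (f x + g x))\<^sup>2) \<partial>lborel)
    \<le> 2 * (\<integral>\<^sup>+ x. ennreal ((cmod (f x))\<^sup>2) \<partial>lborel) + 2 * (\<integral>\<^sup>+ x. ennreal ((cmod (g x))\<^sup>2) \<partial>lborel)"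
proof -
  have "(\<integral>\<^sup>+ x. ennreal ((cmod (f x + g x))\<^sup>2) \<partial>lborel)
    \<le> (\<integral>\<^sup>+ x. 2 * ennreal ((cmod (f x))\<^sup>2) + 2 * ennreal ((cmod (g x))\<^sup>2) \<partial>lborel)"
  proof (rule nn_integral_mono)
    fix x
    have "2 * ennreal ((cmod (f x))\<^sup>2) + 2 * ennreal ((cmod (g x))\<^sup>2)
      = ennreal (2 * (cmod (f x))\<^sup>2 + 2 * (cmod (g x))\<^sup>2)"
      by (simp add: ennreal_plus ennreal_mult)
    then show "ennreal ((cmod (f x + g x))\<^sup>2) \<le> 2 * ennreal ((cmod (f x))\<^sup>2) + 2 * ennreal ((cmod (g x))\<^sup>2)"
      by (simp only: cmod_add_square_le ennreal_leI)
  qed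
  also have "\<dots> = 2 * (\<integral>\<^sup>+ x. ennreal ((cmod (f x))\<^sup>2) \<partial>lborel) + 2 * (\<integral>\<^sup>+ x. ennreal ((cmod (g x))\<^sup>2) \<partial>lborel)"
    by (subst nn_integral_add) (auto simp: nn_integral_cmult)
  finally show ?thesis .
qed

lemma ennreal_tendsto_0_le:
  fixes f g :: "nat \<Rightarrow> ennreal"
  assumes "\<And>n. f n \<le> g n" "g \<longlonglongrightarrow> 0"
  shows "f \<longlonglongrightarrow> 0"
  by (rule tendsto_sandwich[OF _ _ tendsto_const assms(2)]) (simp_all add: assms(1))

lemma has_fourier_transform_linear:
  assumes f: "has_fourier_transform f F" and g: "has_fourier_transform g H"
  shows "has_fourier_transform (\<lambda>x. a * f x + b * g x) (\<lambda>\<xi>. a * F \<xi> + b * H \<xi>)"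
proof -
  have sq: "square_integrable f" "square_integrable F" "square_integrable g" "square_integrable H"
    using f g by (auto simp: has_fourier_transform_def)
  then have [measurable]: "F \<in> borel_measurable borel" "H \<in> borel_measurable borel"
    by (auto simp: square_integrable_def)
  define A where "A n = (\<integral>\<^sup>+ \<xi>. ennreal ((cmod (truncated_fourier n f \<xi> - F \<xi>))\<^sup>2) \<partial>lborel)" for n
  define B where "B n = (\<integral>\<^sup>+ \<xi>. ennreal ((cmod (truncated_fourier n g \<xi> - H \<xi>))\<^sup>2) \<partial>lborel)" for n
  have lim: "A \<longlonglongrightarrow> 0" "B \<longlonglongrightarrow> 0"
    using f g by (auto simp: has_fourier_transform_def A_def[abs_def] B_def[abs_def])
  have le: "(\<integral>\<^sup>+ \<xi>. ennreal ((cmod (truncated_fourier n (\<lambda>x. a * f x + b * g x) \<xi> - (a * F \<xi> + b * H \<xi>)))\<^sup>2) \<partial>lborel)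
     \<le> 2 * (ennreal ((cmod a)\<^sup>2) * A n) + 2 * (ennreal ((cmod b)\<^sup>2) * B n)" (is "?L n \<le> _") for n
  proof -
    note [measurable] = truncated_fourier_measurable[OF sq(1)] truncated_fourier_measurable[OF sq(3)]
    have "?L n = (\<integral>\<^sup>+ \<xi>. ennreal ((cmod (a * (truncated_fourier n f \<xi> - F \<xi>) + b * (truncated_fourier n g \<xi> - H \<xi>)))\<^sup>2) \<partial>lborel)"
      using sq by (simp add: truncated_fourier_linear algebra_simps)
    also have "\<dots> \<le> 2 * (\<integral>\<^sup>+ \<xi>. ennreal ((cmod (a * (truncated_fourier n f \<xi> - F \<xi>)))\<^sup>2) \<partial>lborel)
        + 2 * (\<integral>\<^sup>+ \<xi>. ennreal ((cmod (b * (truncated_fourier n g \<xi> - H \<xi>)))\<^sup>2) \<partial>lborel)"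
      by (rule nn_integral_cmod_add_square_le) auto
    also have "\<dots> = 2 * (ennreal ((cmod a)\<^sup>2) * A n) + 2 * (ennreal ((cmod b)\<^sup>2) * B n)"
      unfolding A_def B_def
      by (simp add: norm_mult power_mult_distrib ennreal_mult nn_integral_cmult)
    finally show ?thesis .
  qed
  have "(\<lambda>n. 2 * (ennreal ((cmod a)\<^sup>2) * A n) + 2 * (ennreal ((cmod b)\<^sup>2) * B n)) \<longlonglongrightarrow>
      2 * (ennreal ((cmod a)\<^sup>2) * 0) + 2 * (ennreal ((cmod b)\<^sup>2) * 0)"
    by (intro tendsto_add ennreal_tendsto_cmult lim) auto
  then have "?L \<longlonglongrightarrow> 0"
    by (intro ennreal_tendsto_0_le[OF le]) simp
  then show ?thesis
    unfolding has_fourier_transform_def by (intro conjI square_integrable_linear sq)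
qed

text \<open>Both functions are L^2 limits of the same truncated transforms, so inserting a truncated
  transform between them bounds their squared distance by a null sequence.\<close>

lemma has_fourier_transform_unique:
  assumes "has_fourier_transform f F" "has_fourier_transform f H"
  shows "AE \<xi> in lborel. F \<xi> = H \<xi>"
proof -
  have sq: "square_integrable f" "square_integrable F" "square_integrable H"
    using assms by (auto simp: has_fourier_transform_def)
  note [measurable] = truncated_fourier_measurable[OF sq(1)]
  from sq have [measurable]: "F \<in> borel_measurable borel" "H \<in> borel_measurable borel"
    by (auto simp: square_integrable_def)
  define A where "A n = (\<integral>\<^sup>+ \<xi>. ennreal ((cmod (truncated_fourier n f \<xi> - F \<xi>))\<^sup>2) \<partial>lborel)" for n
  define B where "B n = (\<integral>\<^sup>+ \<xi>. ennreal ((cmod (truncated_fourier n f \<xi> - H \<xi>))\<^sup>2) \<partial>lborel)" for n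
  have lim: "A \<longlonglongrightarrow> 0" "B \<longlonglongrightarrow> 0"
    using assms by (auto simp: has_fourier_transform_def A_def[abs_def] B_def[abs_def])
  let ?D = "\<integral>\<^sup>+ \<xi>. ennreal ((cmod (F \<xi> - H \<xi>))\<^sup>2) \<partial>lborel"
  have "?D \<le> 2 * A n + 2 * B n" for n
    using nn_integral_cmod_add_square_le[of "\<lambda>\<xi>. F \<xi> - truncated_fourier n f \<xi>" "\<lambda>\<xi>. truncated_fourier n f \<xi> - H \<xi>"]
    by (simp add: A_def B_def norm_minus_commute)
  moreover have "(\<lambda>n. 2 * A n + 2 * B n) \<longlonglongrightarrow> 2 * 0 + 2 * 0"
    by (intro tendsto_add ennreal_tendsto_cmult lim) auto
  ultimately have "?D \<le> 0"
    by (intro tendsto_le[OF _ _ tendsto_const]) auto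
  then have "?D = 0" by simp
  then have "AE \<xi> in lborel. ennreal ((cmod (F \<xi> - H \<xi>))\<^sup>2) = 0"
    by (subst (asm) nn_integral_0_iff_AE) auto
  then show ?thesis by eventually_elim simp
qed

section \<open>The multiplication formula for the Fourier--Plancherel transform\<close>

lemma integrable_pair_mult:
  fixes f g :: "real \<Rightarrow> complex"
  assumes f: "integrable lborel f" and g: "integrable lborel g"
  shows "integrable (lborel \<Otimes>\<^sub>M lborel) (\<lambda>(x, y). f x * g y)"
proof (rule lborel_pair.Fubini_integrable)
  have [measurable]: "f \<in> borel_measurable borel" "g \<in> borel_measurable borel"
    using f g by auto
  show "(\<lambda>(x, y). f x * g y) \<in> borel_measurable (lborel \<Otimes>\<^sub>M lborel)"
    by measurable
  show "integrable lborel (\<lambda>x. LINT y|lborel. norm (case (x, y) of (x, y) \<Rightarrow> f x * g y))"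
    using f g by (simp add: norm_mult)
  show "AE x in lborel. integrable lborel (\<lambda>y. case (x, y) of (x, y) \<Rightarrow> f x * g y)"
    using g by simp
qed

text \<open>Fubini gives the formula for the truncated transforms. As the truncation is removed, the
  left side converges by Cauchy-Schwarz and the right side by dominated convergence, the dominating
  function being \<open>f\<close> times the transform of \<open>\<phi>\<close>. Assumption
  \<open>\<psi>\<close> makes this product integrable; for Gaussians it is verified
  explicitly.\<close>

lemma has_fourier_transform_duality:
  fixes \<phi> :: "real \<Rightarrow> complex"
  assumes F: "has_fourier_transform f F" and \<phi>: "integrable lborel \<phi>" "square_integrable \<phi>"
    and \<psi>: "square_integrable (\<lambda>y. LINT \<xi>|lborel. cis (- (\<xi> * y)) * \<phi> \<xi>)"
  shows "(LINT \<xi>|lborel. F \<xi> * \<phi> \<xi>) = (LINT y|lborel. f y * (LINT \<xi>|lborel. cis (- (\<xi> * y)) * \<phi> \<xi>))"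
proof -
  have sq: "square_integrable f" "square_integrable F"
    using F by (auto simp: has_fourier_transform_def)
  note [measurable] = truncated_fourier_measurable[OF sq(1)]
  from sq \<phi> have [measurable]: "f \<in> borel_measurable borel" "F \<in> borel_measurable borel" "\<phi> \<in> borel_measurable borel"
    by (auto simp: square_integrable_def)
  define \<psi>' where "\<psi>' y = (LINT \<xi>|lborel. cis (- (\<xi> * y)) * \<phi> \<xi>)" for y
  have [measurable]: "\<psi>' \<in> borel_measurable borel" using \<psi> by (simp add: \<psi>'_def[abs_def] square_integrable_def)
  define A where "A n = (\<integral>\<^sup>+ \<xi>. ennreal ((cmod (truncated_fourier n f \<xi> - F \<xi>))\<^sup>2) \<partial>lborel)" for n
  have A: "A \<longlonglongrightarrow> 0"
    using F by (auto simp: has_fourier_transform_def A_def[abs_def])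
  let ?f = "\<lambda>n x. indicator {- real n..real n} x *\<^sub>R f x"
  \<comment> \<open>Truncation makes \<open>f\<close> integrable and hence the double integral
    absolutely convergent; \<open>f\<close> itself is only known to be in L^2.\<close>
  have prod: "integrable (lborel \<Otimes>\<^sub>M lborel) (\<lambda>(\<xi>, y). cis (- (\<xi> * y)) * ?f n y * \<phi> \<xi>)" for n
  proof (rule Bochner_Integration.integrable_bound[where f = "\<lambda>(\<xi>, y). \<phi> \<xi> * ?f n y"])
    have fn: "integrable lborel (?f n)"
      using square_integrable_truncated[OF sq(1), of "- real n" "real n"] by (simp add: set_integrable_def)
    show "integrable (lborel \<Otimes>\<^sub>M lborel) (\<lambda>(\<xi>, y). \<phi> \<xi> * ?f n y)"
      by (rule integrable_pair_mult[OF \<phi>(1) fn])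
    show "AE x in lborel \<Otimes>\<^sub>M lborel. norm (case x of (\<xi>, y) \<Rightarrow> cis (- (\<xi> * y)) * ?f n y * \<phi> \<xi>)
         \<le> norm (case x of (\<xi>, y) \<Rightarrow> \<phi> \<xi> * ?f n y)"
      by (auto simp: norm_mult)
  qed measurable
  have T\<phi>: "truncated_fourier n f \<xi> * \<phi> \<xi> = (LINT y|lborel. cis (- (\<xi> * y)) * ?f n y * \<phi> \<xi>)" for n \<xi>
    unfolding truncated_fourier_eq by (rule integral_mult_left_zero[symmetric])
  have T\<phi>_int: "integrable lborel (\<lambda>\<xi>. truncated_fourier n f \<xi> * \<phi> \<xi>)" for n
    unfolding T\<phi> by (rule lborel_pair.integrable_fst[OF prod])
  have F\<phi>_int: "integrable lborel (\<lambda>\<xi>. F \<xi> * \<phi> \<xi>)"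
    by (rule square_integrable_mult_integrable[OF sq(2) \<phi>(2)])
  have eq: "(LINT \<xi>|lborel. truncated_fourier n f \<xi> * \<phi> \<xi>) = (LINT y|lborel. ?f n y * \<psi>' y)" for n
  proof -
    have "(LINT \<xi>|lborel. truncated_fourier n f \<xi> * \<phi> \<xi>)
      = (LINT \<xi>|lborel. LINT y|lborel. cis (- (\<xi> * y)) * ?f n y * \<phi> \<xi>)"
      by (simp only: T\<phi>)
    also have "\<dots> = (LINT y|lborel. LINT \<xi>|lborel. cis (- (\<xi> * y)) * ?f n y * \<phi> \<xi>)"
      using lborel_pair.Fubini_integral[OF prod] by simp
    also have "\<dots> = (LINT y|lborel. LINT \<xi>|lborel. ?f n y * (cis (- (\<xi> * y)) * \<phi> \<xi>))"
      by (simp add: mult_ac)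
    also have "\<dots> = (LINT y|lborel. ?f n y * \<psi>' y)"
    proof -
      have "integrable lborel (\<lambda>\<xi>. cis (- (\<xi> * y)) * \<phi> \<xi>)" for y
        by (rule Bochner_Integration.integrable_bound[OF \<phi>(1)]) (auto simp: norm_mult)
      then show ?thesis by (simp add: \<psi>'_def)
    qed
    finally show ?thesis .
  qed
  have "(\<lambda>n. LINT y|lborel. ?f n y * \<psi>' y) \<longlonglongrightarrow> (LINT y|lborel. f y * \<psi>' y)"
  proof (rule integral_dominated_convergence[where w = "\<lambda>y. norm (f y * \<psi>' y)"])
    show "integrable lborel (\<lambda>y. norm (f y * \<psi>' y))"
      using square_integrable_mult_integrable[OF sq(1) \<psi>] by (simp add: \<psi>'_def)
    show "AE y in lborel. (\<lambda>n. ?f n y * \<psi>' y) \<longlonglongrightarrow> f y * \<psi>' y"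
    proof (rule AE_I2)
      fix y :: real
      obtain N :: nat where "\<bar>y\<bar> \<le> real N" using real_arch_simple by blast
      then have "\<forall>\<^sub>F n in sequentially. ?f n y * \<psi>' y = f y * \<psi>' y"
        by (intro eventually_sequentiallyI[of N]) (auto simp: indicator_def)
      then show "(\<lambda>n. ?f n y * \<psi>' y) \<longlonglongrightarrow> f y * \<psi>' y"
        by (rule tendsto_eventually)
    qed
  qed (auto simp: indicator_def)
  moreover have "(\<lambda>n. LINT \<xi>|lborel. truncated_fourier n f \<xi> * \<phi> \<xi>) \<longlonglongrightarrow> (LINT \<xi>|lborel. F \<xi> * \<phi> \<xi>)"
  proof -
    define C where "C = (\<integral>\<^sup>+ \<xi>. ennreal ((cmod (\<phi> \<xi>))\<^sup>2) \<partial>lborel)"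
    have C: "C < top"
      using \<phi>(2) by (simp add: C_def square_integrable_def integrable_iff_bounded)
    define d where "d n = (LINT \<xi>|lborel. truncated_fourier n f \<xi> * \<phi> \<xi>) - (LINT \<xi>|lborel. F \<xi> * \<phi> \<xi>)" for n
    \<comment> \<open>Cauchy-Schwarz is used in \<open>ennreal\<close>, because \<open>A n\<close>
      is an extended integral whose finiteness has not been established for each
      \<open>n\<close>.\<close>
    have le: "ennreal ((cmod (d n))\<^sup>2)
      \<le> C * A n" for n
    proof -
      have d: "d n = (LINT \<xi>|lborel. (truncated_fourier n f \<xi> - F \<xi>) * \<phi> \<xi>)"
        using T\<phi>_int F\<phi>_int by (simp add: d_def left_diff_distrib)
      have "ennreal (cmod (d n)) \<le> (\<integral>\<^sup>+ \<xi>. norm ((truncated_fourier n f \<xi> - F \<xi>) * \<phi> \<xi>) \<partial>lborel)"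
        unfolding d using T\<phi>_int F\<phi>_int by (intro integral_norm_bound_ennreal) (auto simp: left_diff_distrib)
      also have "\<dots> = (\<integral>\<^sup>+ \<xi>. ennreal (cmod (truncated_fourier n f \<xi> - F \<xi>)) * ennreal (cmod (\<phi> \<xi>)) \<partial>lborel)"
        by (simp add: norm_mult ennreal_mult)
      finally have "(ennreal (cmod (d n)))\<^sup>2 \<le> (\<dots>)\<^sup>2" by (rule power_mono) simp
      also have "\<dots> \<le> (\<integral>\<^sup>+ \<xi>. (ennreal (cmod (truncated_fourier n f \<xi> - F \<xi>)))\<^sup>2 \<partial>lborel) * (\<integral>\<^sup>+ \<xi>. (ennreal (cmod (\<phi> \<xi>)))\<^sup>2 \<partial>lborel)"
        by (rule Cauchy_Schwarz_nn_integral) auto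
      also have "\<dots> = C * A n" by (simp add: A_def C_def ennreal_power mult.commute)
      finally show ?thesis by (simp add: ennreal_power)
    qed
    have "(\<lambda>n. C * A n) \<longlonglongrightarrow> C * 0"
      by (intro ennreal_tendsto_cmult A C)
    then have "(\<lambda>n. ennreal ((cmod (d n))\<^sup>2)) \<longlonglongrightarrow> 0"
      unfolding mult_zero_right by (rule ennreal_tendsto_0_le[OF le])
    then have "(\<lambda>n. (cmod (d n))\<^sup>2) \<longlonglongrightarrow> 0"
      using tendsto_ennreal_iff[of "\<lambda>n. (cmod (d n))\<^sup>2" sequentially 0] by (simp only: ennreal_0) simp
    then have "(\<lambda>n. cmod (d n)) \<longlonglongrightarrow> 0"
      by (subst (asm) power_tendsto_0_iff) simp_all
    then have "d \<longlonglongrightarrow> 0"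
      by (rule tendsto_norm_zero_cancel)
    then show ?thesis unfolding d_def by (rule LIM_zero_cancel)
  qed
  ultimately show ?thesis
    unfolding eq \<psi>'_def[symmetric] using LIMSEQ_unique by blast
qed

section \<open>Gaussian test functions and the inversion formula\<close>

lemma cis_integral_std_normal:
  "(LINT z|lborel. cis (t * z) * complex_of_real (exp (- z\<^sup>2 / 2))) = complex_of_real (sqrt (2 * pi) * exp (- t\<^sup>2 / 2))"
proof -
  \<comment> \<open>The integral is the characteristic function of the standard normal distribution,
    up to the normalisation of its density.\<close>
  have "complex_of_real (exp (- (t^2) / 2)) = char std_normal_distribution t"
    by (simp add: char_std_normal_distribution)
  also have "\<dots> = (LINT z|lborel. std_normal_density z *\<^sub>R cis (t * z))"
    unfolding char_def by (subst integral_density) (auto simp: normal_density_nonneg cis_conv_exp)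
  also have "\<dots> = (LINT z|lborel. complex_of_real (1 / sqrt (2 * pi)) * (cis (t * z) * complex_of_real (exp (- z\<^sup>2 / 2))))"
    by (intro Bochner_Integration.integral_cong) (auto simp: std_normal_density_def scaleR_conv_of_real)
  also have "\<dots> = complex_of_real (1 / sqrt (2 * pi)) * (LINT z|lborel. cis (t * z) * complex_of_real (exp (- z\<^sup>2 / 2)))"
    by (rule integral_mult_right_zero)
  finally show ?thesis
    by (simp add: field_simps)
qed

lemma integrable_gauss: 
  assumes "c \<noteq> 0"
  shows "integrable lborel (\<lambda>z::real. exp (- (c * z + d)\<^sup>2 / 2))"
proof -
  have "integrable lborel (\<lambda>z. sqrt (2 * pi) * std_normal_density z)"
    by (intro integrable_mult_right integrable_normal_density) auto
  then have "integrable lborel (\<lambda>z::real. exp (- z\<^sup>2 / 2))"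
    by (simp add: std_normal_density_def)
  from lborel_integrable_real_affine[OF this, of c d] assms show ?thesis
    by (simp add: add.commute)
qed

text \<open>The bounded factor \<open>h\<close> admits modulations and constants alike. The Gaussian
  has values between 0 and 1, so its square is bounded by itself.\<close>

lemma square_integrable_gauss:
  assumes "c \<noteq> 0" and [measurable]: "h \<in> borel_measurable borel" and h: "\<And>z. cmod (h z) \<le> C"
  shows "square_integrable (\<lambda>z. h z * complex_of_real (exp (- (c * z + d)\<^sup>2 / 2)))"
  unfolding square_integrable_def
proof
  show "integrable lborel (\<lambda>x. (cmod (h x * complex_of_real (exp (- (c * x + d)\<^sup>2 / 2))))\<^sup>2)"
  proof (rule Bochner_Integration.integrable_bound)
    show "integrable lborel (\<lambda>x. C\<^sup>2 * exp (- (c * x + d)\<^sup>2 / 2))"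
      by (intro integrable_mult_right integrable_gauss assms)
    have "(cmod (h x * complex_of_real (exp (- (c * x + d)\<^sup>2 / 2))))\<^sup>2 \<le> C\<^sup>2 * exp (- (c * x + d)\<^sup>2 / 2)" for x
    proof -
      have "(cmod (h x))\<^sup>2 \<le> C\<^sup>2" by (intro power_mono h) auto
      moreover have "(exp (- (c * x + d)\<^sup>2 / 2))\<^sup>2 \<le> exp (- (c * x + d)\<^sup>2 / 2)"
        unfolding power2_eq_square by (rule mult_left_le) auto
      ultimately show ?thesis
        by (simp add: norm_mult power_mult_distrib mult_mono)
    qed
    then show "AE x in lborel. norm ((cmod (h x * complex_of_real (exp (- (c * x + d)\<^sup>2 / 2))))\<^sup>2)
       \<le> norm (C\<^sup>2 * exp (- (c * x + d)\<^sup>2 / 2))"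
      by simp
  qed measurable
qed measurable

lemma cis_integral_gauss:
  assumes "e > 0"
  shows "(LINT \<xi>|lborel. cis (t * \<xi>) * complex_of_real (exp (- (e * \<xi>)\<^sup>2 / 2)))
    = complex_of_real (sqrt (2 * pi) / e * exp (- (t / e)\<^sup>2 / 2))"
proof -
  have "(LINT z|lborel. cis ((t / e) * z) * complex_of_real (exp (- z\<^sup>2 / 2)))
      = e *\<^sub>R (LINT \<xi>|lborel. cis (t * \<xi>) * complex_of_real (exp (- (e * \<xi>)\<^sup>2 / 2)))"
    using assms by (subst lborel_integral_real_affine[where c = e and t = 0]) auto
  then show ?thesis
    using assms unfolding cis_integral_std_normal
    by (simp add: scaleR_conv_of_real field_simps)
qed

lemma square_integrable_scaled_gauss:
  assumes e: "e > 0"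
  shows "square_integrable (\<lambda>y. complex_of_real (c * exp (- ((x - y) / e)\<^sup>2 / 2)))"
proof -
  have eq: "(- inverse e) * y + x / e = (x - y) / e" for y
    by (simp add: divide_inverse algebra_simps)
  have "square_integrable (\<lambda>y. complex_of_real c * complex_of_real (exp (- ((- inverse e) * y + x / e)\<^sup>2 / 2)))"
    by (rule square_integrable_gauss[where C = "\<bar>c\<bar>"]) (use e in auto)
  then show ?thesis
    unfolding eq of_real_mult .
qed

text \<open>Duality with a modulated Gaussian: its transform is a Gaussian of width \<open>e\<close>
  centred at \<open>x\<close>. The left side is thus the inversion integral with a convergence
  factor, the right side an approximate identity acting on \<open>f\<close>.\<close>

lemma fourier_inversion_regularised:
  assumes F: "has_fourier_transform f F" and e: "e > 0"
  shows "(LINT \<xi>|lborel. F \<xi> * (cis (x * \<xi>) * complex_of_real (exp (- (e * \<xi>)\<^sup>2 / 2))))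
    = (LINT y|lborel. f y * complex_of_real (sqrt (2 * pi) / e * exp (- ((x - y) / e)\<^sup>2 / 2)))"
proof -
  let ?\<phi> = "\<lambda>\<xi>. cis (x * \<xi>) * complex_of_real (exp (- (e * \<xi>)\<^sup>2 / 2))"
  have \<psi>: "(LINT \<xi>|lborel. cis (- (\<xi> * y)) * ?\<phi> \<xi>)
      = complex_of_real (sqrt (2 * pi) / e * exp (- ((x - y) / e)\<^sup>2 / 2))" for y
  proof -
    have "cis (- (\<xi> * y)) * ?\<phi> \<xi> = cis ((x - y) * \<xi>) * complex_of_real (exp (- (e * \<xi>)\<^sup>2 / 2))" for \<xi>
      by (simp add: mult.assoc[symmetric] cis_mult algebra_simps)
    then show ?thesis by (simp only: cis_integral_gauss[OF e])
  qed
  show ?thesis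
  proof (rule has_fourier_transform_duality[OF F, of ?\<phi>, unfolded \<psi>])
    show "square_integrable ?\<phi>"
      using square_integrable_gauss[of e "\<lambda>\<xi>. cis (x * \<xi>)" 1 0] e by simp
    show "integrable lborel ?\<phi>"
      by (rule Bochner_Integration.integrable_bound[OF integrable_gauss[of e 0]])
        (use e in \<open>auto simp: norm_mult\<close>)
    show "square_integrable (\<lambda>y. complex_of_real (sqrt (2 * pi) / e * exp (- ((x - y) / e)\<^sup>2 / 2)))"
      by (rule square_integrable_scaled_gauss[OF e])
  qed
qed

text \<open>The exponent is split into two equal halves. One yields a factor 4 e^2, which beats
  \<open>1 / e\<close>; the other leaves a Gaussian independent of \<open>e\<close> to integrate
  against.\<close>

lemma gauss_tail_le:
  fixes w e :: real
  assumes "0 < e" "e \<le> 1" "1 \<le> \<bar>w\<bar>"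
  shows "1 / e * exp (- (w / e)\<^sup>2 / 2) \<le> 4 * e * exp (- w\<^sup>2 / 4)"
proof -
  have w: "1 \<le> w\<^sup>2" using assms by (simp add: abs_le_square_iff[of 1 w, simplified])
  have "(w / e)\<^sup>2 / 2 = w\<^sup>2 / (4 * e\<^sup>2) + w\<^sup>2 / (4 * e\<^sup>2)"
    using assms by (simp add: power_divide field_simps)
  moreover have "1 / (4 * e\<^sup>2) \<le> w\<^sup>2 / (4 * e\<^sup>2)"
    using w assms by (simp add: divide_right_mono)
  moreover have "w\<^sup>2 / 4 \<le> w\<^sup>2 / (4 * e\<^sup>2)"
    using assms w by (intro divide_left_mono) (auto simp: power_le_one)
  ultimately have "- (w / e)\<^sup>2 / 2 \<le> - (1 / (4 * e\<^sup>2)) + (- w\<^sup>2 / 4)" by simp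
  then have "exp (- (w / e)\<^sup>2 / 2) \<le> exp (- (1 / (4 * e\<^sup>2))) * exp (- w\<^sup>2 / 4)"
    by (simp flip: exp_add)
  moreover have "exp (- (1 / (4 * e\<^sup>2))) \<le> 4 * e\<^sup>2"
  proof -
    have "1 / (4 * e\<^sup>2) \<le> exp (1 / (4 * e\<^sup>2))"
      using exp_ge_add_one_self[of "1 / (4 * e\<^sup>2)"] by linarith
    then have "inverse (exp (1 / (4 * e\<^sup>2))) \<le> inverse (1 / (4 * e\<^sup>2))"
      using assms by (intro le_imp_inverse_le) auto
    then show ?thesis by (simp add: exp_minus)
  qed
  ultimately have "exp (- (w / e)\<^sup>2 / 2) \<le> 4 * e\<^sup>2 * exp (- w\<^sup>2 / 4)"
    by (meson exp_ge_zero mult_right_mono order_trans)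
  then show ?thesis
    using assms by (simp add: field_simps power2_eq_square)
qed

text \<open>The width in the regularised formula tends to zero. The left side converges to the
  inversion integral, dominated by |F|. The kernel on the right has total mass 2 pi: on a window
  around \<open>x\<close> continuity of \<open>f\<close> produces the limit, and outside it the
  Gaussian tail bound is paired with \<open>f\<close> in L^2.\<close>

lemma fourier_inversion:
  assumes F: "has_fourier_transform f F" and cont: "continuous_on UNIV f" and int: "integrable lborel F"
  shows "f x = (LINT \<xi>|lborel. F \<xi> * cis (x * \<xi>)) / complex_of_real (2 * pi)"
proof -
  define e where "e n = 1 / real (Suc n)" for n
  have e: "0 < e n" "e n \<le> 1" for n by (auto simp: e_def)
  have e0: "e \<longlonglongrightarrow> 0"
    unfolding e_def by (rule LIMSEQ_Suc[OF lim_1_over_n])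
  have sq: "square_integrable f"
    using F by (auto simp: has_fourier_transform_def)
  have [measurable]: "f \<in> borel_measurable borel" "F \<in> borel_measurable borel"
    using sq int by (auto simp: square_integrable_def)
  define I where "I n = (LINT \<xi>|lborel. F \<xi> * (cis (x * \<xi>) * complex_of_real (exp (- (e n * \<xi>)\<^sup>2 / 2))))" for n
  have I1: "I \<longlonglongrightarrow> (LINT \<xi>|lborel. F \<xi> * cis (x * \<xi>))"
    unfolding I_def
  proof (rule integral_dominated_convergence[where w = "\<lambda>\<xi>. cmod (F \<xi>)"])
    show "AE \<xi> in lborel. (\<lambda>n. F \<xi> * (cis (x * \<xi>) * complex_of_real (exp (- (e n * \<xi>)\<^sup>2 / 2)))) \<longlonglongrightarrow> F \<xi> * cis (x * \<xi>)"
    proof (rule AE_I2)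
      fix \<xi>
      have "(\<lambda>n. F \<xi> * (cis (x * \<xi>) * complex_of_real (exp (- (e n * \<xi>)\<^sup>2 / 2)))) \<longlonglongrightarrow>
         F \<xi> * (cis (x * \<xi>) * complex_of_real (exp (- (0 * \<xi>)\<^sup>2 / 2)))"
        by (intro tendsto_intros e0) auto
      then show "(\<lambda>n. F \<xi> * (cis (x * \<xi>) * complex_of_real (exp (- (e n * \<xi>)\<^sup>2 / 2)))) \<longlonglongrightarrow> F \<xi> * cis (x * \<xi>)"
        by simp
    qed
    show "AE \<xi> in lborel. norm (F \<xi> * (cis (x * \<xi>) * complex_of_real (exp (- (e n * \<xi>)\<^sup>2 / 2)))) \<le> cmod (F \<xi>)" for n
      by (auto simp: norm_mult intro!: AE_I2 mult_left_le)
  qed (use int in auto)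
  let ?k = "\<lambda>n y. complex_of_real (sqrt (2 * pi) / e n * exp (- ((x - y) / e n)\<^sup>2 / 2))"
  let ?B = "\<lambda>y. indicator {x - 1..x + 1} y"
  have kint: "square_integrable (?k n)" for n
    by (rule square_integrable_scaled_gauss[OF e(1)])
  have fk: "integrable lborel (\<lambda>y. f y * ?k n y)" for n
    by (rule square_integrable_mult_integrable[OF sq kint])
  define N where "N n = (LINT y|lborel. ?B y *\<^sub>R (f y * ?k n y))" for n
  define R where "R n = (LINT y|lborel. indicator (- {x - 1..x + 1}) y *\<^sub>R (f y * ?k n y))" for n
  have INR: "I n = N n + R n" for n
  proof -
    have "I n = (LINT y|lborel. f y * ?k n y)"
      unfolding I_def by (rule fourier_inversion_regularised[OF F e(1)])
    also have "\<dots> = (LINT y|lborel. ?B y *\<^sub>R (f y * ?k n y) + indicator (- {x - 1..x + 1}) y *\<^sub>R (f y * ?k n y))"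
      by (intro Bochner_Integration.integral_cong) (auto simp: indicator_def)
    also have "\<dots> = N n + R n"
      unfolding N_def R_def by (intro Bochner_Integration.integral_add integrable_mult_indicator fk) auto
    finally show ?thesis .
  qed
  have R: "R \<longlonglongrightarrow> 0"
  proof (rule Lim_null_comparison)
    \<comment> \<open>The factor sqrt(1/2) writes exp(-(x - y)^2 / 4) in the form required by
      \<open>square_integrable_gauss\<close>; the constant \<open>K\<close> does not depend on
      \<open>n\<close>.\<close>
    define K where "K = (LINT y|lborel. cmod (f y * complex_of_real (exp (- (sqrt (1 / 2) * y + (- sqrt (1 / 2) * x))\<^sup>2 / 2))))"
    have sqe: "(sqrt (1 / 2) * y + (- sqrt (1 / 2) * x))\<^sup>2 / 2 = (x - y)\<^sup>2 / 4" for y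
    proof -
      have "sqrt (1 / 2) * y + (- sqrt (1 / 2) * x) = sqrt (1 / 2) * (y - x)" by (simp only: algebra_simps)
      then show ?thesis by (simp add: power_mult_distrib power2_commute del: real_sqrt_divide)
    qed
    have Kint: "integrable lborel (\<lambda>y. f y * complex_of_real (exp (- (sqrt (1 / 2) * y + (- sqrt (1 / 2) * x))\<^sup>2 / 2)))"
      using square_integrable_gauss[of "sqrt (1 / 2)" "\<lambda>_. 1" 1 "- sqrt (1 / 2) * x"]
      by (intro square_integrable_mult_integrable[OF sq]) simp
    show "\<forall>\<^sub>F n in sequentially. norm (R n) \<le> sqrt (2 * pi) * 4 * e n * K"
    proof (intro always_eventually allI)
      fix n
      have "norm (R n) \<le> (LINT y|lborel. sqrt (2 * pi) * 4 * e n * cmod (f y * complex_of_real (exp (- (sqrt (1 / 2) * y + (- sqrt (1 / 2) * x))\<^sup>2 / 2))))"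
        unfolding R_def
      proof (rule Bochner_Integration.integral_norm_bound_integral)
        show "integrable lborel (\<lambda>y. indicator (- {x - 1..x + 1}) y *\<^sub>R (f y * ?k n y))"
          by (intro integrable_mult_indicator fk) auto
        show "integrable lborel (\<lambda>y. sqrt (2 * pi) * 4 * e n * cmod (f y * complex_of_real (exp (- (sqrt (1 / 2) * y + (- sqrt (1 / 2) * x))\<^sup>2 / 2))))"
          by (intro integrable_mult_right integrable_norm Kint)
        fix y
        have nk: "cmod (?k n y) = sqrt (2 * pi) * (1 / e n * exp (- ((x - y) / e n)\<^sup>2 / 2))"
          using e(1)[of n] by (simp add: norm_mult norm_divide)
        show "norm (indicator (- {x - 1..x + 1}) y *\<^sub>R (f y * ?k n y))
          \<le> sqrt (2 * pi) * 4 * e n * cmod (f y * complex_of_real (exp (- (sqrt (1 / 2) * y + (- sqrt (1 / 2) * x))\<^sup>2 / 2)))"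
        proof (cases "y \<in> {x - 1..x + 1}")
          case True
          then show ?thesis using e(1)[of n] by simp
        next
          case False
          then have "1 \<le> \<bar>x - y\<bar>" by auto
          then have "sqrt (2 * pi) * (1 / e n * exp (- ((x - y) / e n)\<^sup>2 / 2)) \<le> sqrt (2 * pi) * (4 * e n * exp (- (x - y)\<^sup>2 / 4))"
            by (intro mult_left_mono gauss_tail_le e) auto
          then have "cmod (f y) * cmod (?k n y) \<le> cmod (f y) * (sqrt (2 * pi) * (4 * e n * exp (- (x - y)\<^sup>2 / 4)))"
            unfolding nk by (rule mult_left_mono) simp
          moreover have "exp (- (sqrt (1 / 2) * y + (- sqrt (1 / 2) * x))\<^sup>2 / 2) = exp (- (x - y)\<^sup>2 / 4)"
            using sqe[of y] by simp
          moreover have "norm (indicator (- {x - 1..x + 1}) y *\<^sub>R (f y * ?k n y)) = cmod (f y) * cmod (?k n y)"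
          proof -
            have "indicator (- {x - 1..x + 1}) y = (1::real)" using False by (simp add: indicator_def)
            then show ?thesis by (simp only: scaleR_one norm_mult)
          qed
          ultimately show ?thesis
            by (simp only: norm_mult norm_of_real abs_exp_cancel mult_ac)
        qed
      qed
      also have "\<dots> = sqrt (2 * pi) * 4 * e n * K"
        unfolding K_def by (rule integral_mult_right_zero)
      finally show "norm (R n) \<le> sqrt (2 * pi) * 4 * e n * K" .
    qed
    have "(\<lambda>n. sqrt (2 * pi) * 4 * e n * K) \<longlonglongrightarrow> sqrt (2 * pi) * 4 * 0 * K"
      by (intro tendsto_intros e0)
    then show "(\<lambda>n. sqrt (2 * pi) * 4 * e n * K) \<longlonglongrightarrow> 0" by simp
  qed
  have N: "N \<longlonglongrightarrow> complex_of_real (2 * pi) * f x"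
  proof -
    \<comment> \<open>The substitution y = x + e z turns the shrinking kernel into a fixed Gaussian
      and moves the dependence on \<open>n\<close> into the argument of \<open>f\<close> and the
      window.\<close>
    let ?g = "\<lambda>n z. ?B (x + e n * z) *\<^sub>R (f (x + e n * z) * complex_of_real (sqrt (2 * pi) * exp (- z\<^sup>2 / 2)))"
    have Neq: "N n = (LINT z|lborel. ?g n z)" for n
    proof -
      have "N n = e n *\<^sub>R (LINT z|lborel. ?B (x + e n * z) *\<^sub>R (f (x + e n * z) * ?k n (x + e n * z)))"
        unfolding N_def using e(1)[of n]
        by (subst lborel_integral_real_affine[where c = "e n" and t = x]) auto
      also have "\<dots> = (LINT z|lborel. e n *\<^sub>R (?B (x + e n * z) *\<^sub>R (f (x + e n * z) * ?k n (x + e n * z))))"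
        by (rule integral_scaleR_right[symmetric]) 
      also have "\<dots> = (LINT z|lborel. ?g n z)"
      proof (rule Bochner_Integration.integral_cong)
        fix z
        have "(x - (x + e n * z)) / e n = - z" using e(1)[of n] by simp
        then show "e n *\<^sub>R (?B (x + e n * z) *\<^sub>R (f (x + e n * z) * ?k n (x + e n * z))) = ?g n z"
          using e(1)[of n] by (simp add: scaleR_conv_of_real)
      qed simp
      finally show ?thesis .
    qed
    have "compact (f ` {x - 1..x + 1})"
      by (intro compact_continuous_image continuous_on_subset[OF cont]) auto
    then obtain B where B: "\<And>y. y \<in> {x - 1..x + 1} \<Longrightarrow> cmod (f y) \<le> B"
      using compact_imp_bounded bounded_iff by (metis imageI)
    have B0: "0 \<le> B" by (rule order_trans[OF norm_ge_zero B[of x]]) simp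
    have "(\<lambda>n. LINT z|lborel. ?g n z) \<longlonglongrightarrow> (LINT z|lborel. f x * complex_of_real (sqrt (2 * pi) * exp (- z\<^sup>2 / 2)))"
    proof (rule integral_dominated_convergence[where w = "\<lambda>z. B * (sqrt (2 * pi) * exp (- z\<^sup>2 / 2))"])
      show "integrable lborel (\<lambda>z. B * (sqrt (2 * pi) * exp (- z\<^sup>2 / 2)))"
        using integrable_gauss[of 1 0] by (intro integrable_mult_right) simp
      show "AE z in lborel. (\<lambda>n. ?g n z) \<longlonglongrightarrow> f x * complex_of_real (sqrt (2 * pi) * exp (- z\<^sup>2 / 2))"
      proof (rule AE_I2)
        fix z
        have ez: "(\<lambda>n. x + e n * z) \<longlonglongrightarrow> x + 0 * z"
          by (intro tendsto_intros e0)
        have "(\<lambda>n. f (x + e n * z)) \<longlonglongrightarrow> f x"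
          using cont ez continuous_on_tendsto_compose[of UNIV f "\<lambda>n. x + e n * z" x sequentially] by simp
        then have "(\<lambda>n. f (x + e n * z) * complex_of_real (sqrt (2 * pi) * exp (- z\<^sup>2 / 2))) \<longlonglongrightarrow> f x * complex_of_real (sqrt (2 * pi) * exp (- z\<^sup>2 / 2))"
          by (intro tendsto_mult tendsto_const)
        moreover have "\<forall>\<^sub>F n in sequentially. ?g n z = f (x + e n * z) * complex_of_real (sqrt (2 * pi) * exp (- z\<^sup>2 / 2))"
        proof -
          have "\<forall>\<^sub>F n in sequentially. x + e n * z \<in> {x - 1<..<x + 1}"
            using ez by (intro topological_tendstoD[of _ x]) auto
          then show ?thesis by eventually_elim (auto simp: indicator_def)
        qed
        ultimately show "(\<lambda>n. ?g n z) \<longlonglongrightarrow> f x * complex_of_real (sqrt (2 * pi) * exp (- z\<^sup>2 / 2))"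
          by (simp only: tendsto_cong)
      qed
      show "AE z in lborel. norm (?g n z) \<le> B * (sqrt (2 * pi) * exp (- z\<^sup>2 / 2))" for n
      proof (rule AE_I2)
        fix z
        show "norm (?g n z) \<le> B * (sqrt (2 * pi) * exp (- z\<^sup>2 / 2))"
        proof (cases "x + e n * z \<in> {x - 1..x + 1}")
          case True
          then have "norm (?g n z) = cmod (f (x + e n * z)) * (sqrt (2 * pi) * exp (- z\<^sup>2 / 2))"
            by (simp add: norm_mult)
          then show ?thesis using B[OF True] by (simp add: mult_right_mono)
        qed (use B0 in simp)
      qed
    qed measurable
    also have "(LINT z|lborel. f x * complex_of_real (sqrt (2 * pi) * exp (- z\<^sup>2 / 2)))
        = complex_of_real (2 * pi) * f x"
    proof -
      have "(LINT z|lborel. f x * complex_of_real (sqrt (2 * pi) * exp (- z\<^sup>2 / 2)))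
         = (LINT z|lborel. (f x * complex_of_real (sqrt (2 * pi))) * (cis (0 * z) * complex_of_real (exp (- z\<^sup>2 / 2))))"
        by (simp add: mult_ac)
      also have "\<dots> = f x * complex_of_real (sqrt (2 * pi)) * complex_of_real (sqrt (2 * pi) * exp (- 0\<^sup>2 / 2))"
        by (simp only: integral_mult_right_zero cis_integral_std_normal)
      also have "\<dots> = f x * complex_of_real (sqrt (2 * pi) * sqrt (2 * pi))"
      proof -
        have "complex_of_real (sqrt (2 * pi) * exp (- 0\<^sup>2 / 2)) = complex_of_real (sqrt (2 * pi))" by simp
        then show ?thesis by (simp only: of_real_mult mult.assoc)
      qed
      also have "\<dots> = complex_of_real (2 * pi) * f x"
        by (simp del: real_sqrt_mult add: real_sqrt_mult_self mult.commute)
      finally show ?thesis .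
    qed
    finally show ?thesis unfolding Neq .
  qed
  have "I \<longlonglongrightarrow> complex_of_real (2 * pi) * f x + 0"
    unfolding INR by (intro tendsto_add N R)
  with I1 have "(LINT \<xi>|lborel. F \<xi> * cis (x * \<xi>)) = complex_of_real (2 * pi) * f x"
    using LIMSEQ_unique by fastforce
  then show ?thesis by simp
qed

section \<open>Sobolev embedding\<close>

lemma integrable_even:
  fixes h :: "real \<Rightarrow> real"
  assumes [measurable]: "h \<in> borel_measurable borel" and h: "set_integrable lborel {0..} h"
  shows "integrable lborel (\<lambda>x. h \<bar>x\<bar>)"
proof (rule Bochner_Integration.integrable_bound)
  have 1: "integrable lborel (\<lambda>x. \<bar>indicator {0..} x * h x\<bar>)"
    using h unfolding set_integrable_def by (intro integrable_abs) simp
  then have "integrable lborel (\<lambda>x. \<bar>indicator {0..} (0 + (-1) * x) * h (0 + (-1) * x)\<bar>)"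
    by (rule lborel_integrable_real_affine) simp
  then show "integrable lborel (\<lambda>x. \<bar>indicator {0..} x * h x\<bar> + \<bar>indicator {0..} (- x) * h (- x)\<bar>)"
    using 1 by (intro Bochner_Integration.integrable_add) simp_all
  show "AE x in lborel. norm (h \<bar>x\<bar>) \<le> norm (\<bar>indicator {0..} x * h x\<bar> + \<bar>indicator {0..} (- x) * h (- x)\<bar>)"
    by (rule AE_I2) (auto simp: indicator_def abs_if)
qed measurable

text \<open>For a nonnegative integrand the fundamental theorem of calculus gives the integral over
  the half-line as \<open>l - f 0\<close>, which is finite; reflection extends this to the even
  function.\<close>

lemma integrable_FTC_atLeast:
  fixes f h :: "real \<Rightarrow> real"
  assumes [measurable]: "h \<in> borel_measurable borel"
    and "\<And>x. 0 \<le> x \<Longrightarrow> DERIV f x :> h x" "\<And>x. 0 \<le> x \<Longrightarrow> 0 \<le> h x" "(f \<longlongrightarrow> l) at_top"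
  shows "integrable lborel (\<lambda>x. h \<bar>x\<bar>)"
proof (rule integrable_even)
  have "(\<integral>\<^sup>+x. ennreal (h x) * indicator {0..} x \<partial>lborel) = ennreal (l - f 0)"
    by (rule nn_integral_FTC_atLeast) (use assms in auto)
  moreover have "(\<integral>\<^sup>+x. ennreal (norm (indicator {0..} x *\<^sub>R h x)) \<partial>lborel) = (\<integral>\<^sup>+x. ennreal (h x) * indicator {0..} x \<partial>lborel)"
    by (intro nn_integral_cong) (use assms(3) in \<open>auto simp: indicator_def\<close>)
  ultimately show "set_integrable lborel {0..} h"
    unfolding set_integrable_def integrable_iff_bounded by simp
qed (rule assms(1))

lemma integrable_exp_minus_abs:
  assumes "a > 0"
  shows "integrable lborel (\<lambda>x::real. exp (- a * \<bar>x\<bar>))"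
proof (rule integrable_FTC_atLeast[where h = "\<lambda>x. exp (- a * x)" and f = "\<lambda>x. - exp (- a * x) / a" and l = 0])
  show "((\<lambda>x. - exp (- a * x) / a) \<longlongrightarrow> 0) at_top"
    using assms by real_asymp
qed (use assms in \<open>auto intro!: derivative_eq_intros\<close>)

text \<open>Comparison with the power -2r of 1 + |x|, which has an explicit antiderivative vanishing
  at infinity for r > 1/2. This threshold is the source of the Sobolev exponents below.\<close>

lemma integrable_japanese_bracket:
  assumes r: "r > 1 / 2"
  shows "integrable lborel (\<lambda>x::real. (1 + x\<^sup>2) powr (- r))"
proof (rule Bochner_Integration.integrable_bound)
  have "integrable lborel (\<lambda>x::real. (1 + \<bar>x\<bar>) powr (- 2 * r))"
  proof (rule integrable_FTC_atLeast[where h = "\<lambda>x. (1 + x) powr (- 2 * r)" and l = 0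
      and f = "\<lambda>x. - ((1 + x) powr (1 - 2 * r)) / (2 * r - 1)"])
    show "DERIV (\<lambda>x. - ((1 + x) powr (1 - 2 * r)) / (2 * r - 1)) x :> (1 + x) powr (- 2 * r)" if "0 \<le> x" for x
    proof -
      have "DERIV (\<lambda>x. (1 + x) powr (1 - 2 * r)) x :> (1 - 2 * r) * (1 + x) powr (- 2 * r)"
        using that by (auto intro!: derivative_eq_intros)
      then have "DERIV (\<lambda>x. - ((1 + x) powr (1 - 2 * r)) / (2 * r - 1)) x :> - ((1 - 2 * r) * (1 + x) powr (- 2 * r)) / (2 * r - 1)"
        by (intro DERIV_cdivide DERIV_minus)
      moreover have "- ((1 - 2 * r) * (1 + x) powr (- 2 * r)) / (2 * r - 1) = (1 + x) powr (- 2 * r)"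
        using r by (simp add: field_simps)
      ultimately show ?thesis by simp
    qed
    show "((\<lambda>x. - ((1 + x) powr (1 - 2 * r)) / (2 * r - 1)) \<longlongrightarrow> 0) at_top"
      using r by real_asymp
  qed auto
  then show "integrable lborel (\<lambda>x::real. 2 powr r * (1 + \<bar>x\<bar>) powr (- 2 * r))"
    by (rule integrable_mult_right)
  have "(1 + x\<^sup>2) powr (- r) \<le> 2 powr r * (1 + \<bar>x\<bar>) powr (- 2 * r)" for x :: real
  proof -
    have "(1 + \<bar>x\<bar>)\<^sup>2 \<le> 2 * (1 + x\<^sup>2)"
      using sum_squares_bound[of 1 "\<bar>x\<bar>"] by (simp add: power2_sum)
    then have "(1 + x\<^sup>2) powr (- r) \<le> ((1 + \<bar>x\<bar>)\<^sup>2 / 2) powr (- r)"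
      using r by (intro powr_mono2') (auto intro: add_pos_nonneg)
    also have "\<dots> = 2 powr r * ((1 + \<bar>x\<bar>) powr 2) powr (- r)"
      by (simp add: powr_divide powr_minus field_simps)
    also have "\<dots> = 2 powr r * (1 + \<bar>x\<bar>) powr (- 2 * r)"
      by (simp only: powr_powr mult_minus_right mult_minus_left)
    finally show ?thesis .
  qed
  then show "AE x in lborel. norm ((1 + x\<^sup>2) powr (- r)) \<le> norm (2 powr r * (1 + \<bar>x\<bar>) powr (- 2 * r))" by simp
qed measurable

lemma Cauchy_Schwarz_integral:
  fixes f g :: "'a \<Rightarrow> real"
  assumes f: "integrable M (\<lambda>x. (f x)\<^sup>2)" and g: "integrable M (\<lambda>x. (g x)\<^sup>2)"
    and [measurable]: "f \<in> borel_measurable M" "g \<in> borel_measurable M"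
    and nn: "\<And>x. 0 \<le> f x" "\<And>x. 0 \<le> g x"
  shows "integrable M (\<lambda>x. f x * g x)"
    and "(LINT x|M. f x * g x) \<le> sqrt (LINT x|M. (f x)\<^sup>2) * sqrt (LINT x|M. (g x)\<^sup>2)"
proof -
  show int: "integrable M (\<lambda>x. f x * g x)"
  proof (rule Bochner_Integration.integrable_bound)
    show "integrable M (\<lambda>x. (f x)\<^sup>2 + (g x)\<^sup>2)"
      by (rule Bochner_Integration.integrable_add[OF f g])
    have "f x * g x \<le> (f x)\<^sup>2 + (g x)\<^sup>2" for x
      using sum_squares_bound[of "f x" "g x"] mult_nonneg_nonneg[OF nn, of x x] by linarith
    then show "AE x in M. norm (f x * g x) \<le> norm ((f x)\<^sup>2 + (g x)\<^sup>2)"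
      using nn by (simp add: abs_mult)
  qed measurable
  have "ennreal ((LINT x|M. f x * g x)\<^sup>2) = (\<integral>\<^sup>+x. ennreal (f x) * ennreal (g x) \<partial>M)\<^sup>2"
    using nn_integral_eq_integral[OF int] nn by (simp add: ennreal_mult ennreal_power)
  also have "\<dots> \<le> (\<integral>\<^sup>+x. ennreal (f x) ^ 2 \<partial>M) * (\<integral>\<^sup>+x. ennreal (g x) ^ 2 \<partial>M)"
    by (rule Cauchy_Schwarz_nn_integral) auto
  also have "\<dots> = ennreal ((LINT x|M. (f x)\<^sup>2) * (LINT x|M. (g x)\<^sup>2))"
    using nn_integral_eq_integral[OF f] nn_integral_eq_integral[OF g] nn
    by (simp add: ennreal_mult ennreal_power)
  finally have "(LINT x|M. f x * g x)\<^sup>2 \<le> (LINT x|M. (f x)\<^sup>2) * (LINT x|M. (g x)\<^sup>2)"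
    by (subst (asm) ennreal_le_iff) auto
  then show "(LINT x|M. f x * g x) \<le> sqrt (LINT x|M. (f x)\<^sup>2) * sqrt (LINT x|M. (g x)\<^sup>2)"
    by (simp add: real_le_rsqrt flip: real_sqrt_mult)
qed

section \<open>Weighted transforms of functions in \<open>Hs s\<close>\<close>

lemma norm_le_norm_if_nonneg: "0 \<le> a \<Longrightarrow> a \<le> b \<Longrightarrow> norm a \<le> norm b" for a b :: real
  by simp

text \<open>Membership in \<open>Hs s\<close> provides some transform with the weighted bound, while
  \<open>fourier\<close> may choose another one; almost everywhere uniqueness carries the bound
  over.\<close>

lemma Hs_fourier:
  assumes "f \<in> Hs s"
  defines "F \<equiv> fourier (\<lambda>x. complex_of_real (f x))"
  shows "has_fourier_transform (\<lambda>x. complex_of_real (f x)) F"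
    and "integrable lborel (\<lambda>\<xi>. (1 + \<xi>\<^sup>2) powr s * (cmod (F \<xi>))\<^sup>2)"
proof -
  obtain H where H: "has_fourier_transform (\<lambda>x. complex_of_real (f x)) H"
     "integrable lborel (\<lambda>\<xi>. (1 + \<xi>\<^sup>2) powr s * (cmod (H \<xi>))\<^sup>2)"
    using assms by (auto simp: Hs_def)
  show F: "has_fourier_transform (\<lambda>x. complex_of_real (f x)) F"
    unfolding F_def fourier_def by (rule someI[of "has_fourier_transform _", OF H(1)])
  then have [measurable]: "F \<in> borel_measurable borel" "H \<in> borel_measurable borel"
    using H(1) by (auto simp: has_fourier_transform_def square_integrable_def)
  have "AE \<xi> in lborel. H \<xi> = F \<xi>"
    by (rule has_fourier_transform_unique[OF H(1) F])
  then have "AE \<xi> in lborel. (1 + \<xi>\<^sup>2) powr s * (cmod (H \<xi>))\<^sup>2 = (1 + \<xi>\<^sup>2) powr s * (cmod (F \<xi>))\<^sup>2"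
    by eventually_elim simp
  then show "integrable lborel (\<lambda>\<xi>. (1 + \<xi>\<^sup>2) powr s * (cmod (F \<xi>))\<^sup>2)"
    using H(2) by (subst (asm) integrable_cong_AE) auto
qed

lemma Hs_linear:
  assumes f: "f \<in> Hs s" and g: "g \<in> Hs s"
  shows "(\<lambda>x. a * f x + b * g x) \<in> Hs s"
proof -
  define F where "F = fourier (\<lambda>x. complex_of_real (f x))"
  define H where "H = fourier (\<lambda>x. complex_of_real (g x))"
  note F = Hs_fourier[OF f, folded F_def] and H = Hs_fourier[OF g, folded H_def]
  have [measurable]: "F \<in> borel_measurable borel" "H \<in> borel_measurable borel"
    using F(1) H(1) by (auto simp: has_fourier_transform_def square_integrable_def)
  let ?a = "complex_of_real a" and ?b = "complex_of_real b"
  have ft: "has_fourier_transform (\<lambda>x. complex_of_real (a * f x + b * g x)) (\<lambda>\<xi>. ?a * F \<xi> + ?b * H \<xi>)"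
    using has_fourier_transform_linear[OF F(1) H(1), of ?a ?b] by (simp only: of_real_add of_real_mult)
  moreover have "integrable lborel (\<lambda>\<xi>. (1 + \<xi>\<^sup>2) powr s * (cmod (?a * F \<xi> + ?b * H \<xi>))\<^sup>2)"
  proof (rule Bochner_Integration.integrable_bound)
    show "integrable lborel (\<lambda>\<xi>. 2 * a\<^sup>2 * ((1 + \<xi>\<^sup>2) powr s * (cmod (F \<xi>))\<^sup>2)
         + 2 * b\<^sup>2 * ((1 + \<xi>\<^sup>2) powr s * (cmod (H \<xi>))\<^sup>2))"
      by (intro Bochner_Integration.integrable_add integrable_mult_right F(2) H(2))
    have "(1 + \<xi>\<^sup>2) powr s * (cmod (?a * F \<xi> + ?b * H \<xi>))\<^sup>2 \<le> 2 * a\<^sup>2 * ((1 + \<xi>\<^sup>2) powr s * (cmod (F \<xi>))\<^sup>2)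
         + 2 * b\<^sup>2 * ((1 + \<xi>\<^sup>2) powr s * (cmod (H \<xi>))\<^sup>2)" for \<xi>
    proof -
      have "(cmod (?a * F \<xi> + ?b * H \<xi>))\<^sup>2 \<le> 2 * (a\<^sup>2 * (cmod (F \<xi>))\<^sup>2) + 2 * (b\<^sup>2 * (cmod (H \<xi>))\<^sup>2)"
        using cmod_add_square_le[of "?a * F \<xi>" "?b * H \<xi>"] by (simp add: norm_mult power_mult_distrib)
      then have "(1 + \<xi>\<^sup>2) powr s * (cmod (?a * F \<xi> + ?b * H \<xi>))\<^sup>2 \<le> (1 + \<xi>\<^sup>2) powr s * (2 * (a\<^sup>2 * (cmod (F \<xi>))\<^sup>2) + 2 * (b\<^sup>2 * (cmod (H \<xi>))\<^sup>2))"
        by (rule mult_left_mono) simp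
      then show ?thesis by (simp only: algebra_simps)
    qed
    then show "AE \<xi> in lborel. norm ((1 + \<xi>\<^sup>2) powr s * (cmod (?a * F \<xi> + ?b * H \<xi>))\<^sup>2) \<le> norm (2 * a\<^sup>2 * ((1 + \<xi>\<^sup>2) powr s * (cmod (F \<xi>))\<^sup>2)
         + 2 * b\<^sup>2 * ((1 + \<xi>\<^sup>2) powr s * (cmod (H \<xi>))\<^sup>2))"
      by (intro AE_I2 norm_le_norm_if_nonneg) auto
  qed measurable
  moreover have "square_integrable (\<lambda>x. complex_of_real (a * f x + b * g x))"
    using ft by (simp only: has_fourier_transform_def)
  ultimately show ?thesis unfolding Hs_def by blast
qed

text \<open>The integrand is at most (1 + \<xi>^2)^(-(s-k)/2) times (1 + \<xi>^2)^(s/2) |F|. By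
  Cauchy-Schwarz the second factor gives the \<open>Hs\<close> norm, and the first is square
  integrable since s - k > 1/2. The constant depends on \<open>s\<close> and \<open>k\<close>
  only.\<close>

lemma Hs_moment:
  assumes s: "s > real k + 1 / 2"
  shows "\<exists>C\<ge>0. \<forall>f\<in>Hs s. integrable lborel (\<lambda>\<xi>. \<bar>\<xi>\<bar> ^ k * cmod (fourier (\<lambda>x. complex_of_real (f x)) \<xi>)) \<and>
     (LINT \<xi>|lborel. \<bar>\<xi>\<bar> ^ k * cmod (fourier (\<lambda>x. complex_of_real (f x)) \<xi>)) \<le> C * Hs_norm s f"
proof (intro exI conjI ballI)
  let ?a = "\<lambda>\<xi>::real. (1 + \<xi>\<^sup>2) powr (- (s - real k) / 2)"
  define C where "C = sqrt (LINT \<xi>|lborel. (?a \<xi>)\<^sup>2)"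
  show "0 \<le> C" by (simp add: C_def)
  have sq: "(p powr (q / 2))\<^sup>2 = p powr q" if "p > 0" for p q :: real
    using that by (simp add: powr_powr flip: powr_realpow)
  have pos: "0 < 1 + \<xi>\<^sup>2" for \<xi> :: real by (simp add: add_pos_nonneg)
  have a2: "integrable lborel (\<lambda>\<xi>. (?a \<xi>)\<^sup>2)"
    unfolding sq[OF pos] using s by (intro integrable_japanese_bracket) simp
  fix f assume f: "f \<in> Hs s"
  define F where "F = fourier (\<lambda>x. complex_of_real (f x))"
  note F = Hs_fourier[OF f, folded F_def]
  have [measurable]: "F \<in> borel_measurable borel"
    using F(1) by (auto simp: has_fourier_transform_def square_integrable_def)
  let ?b = "\<lambda>\<xi>. (1 + \<xi>\<^sup>2) powr (s / 2) * cmod (F \<xi>)"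
  have bsq: "(?b \<xi>)\<^sup>2 = (1 + \<xi>\<^sup>2) powr s * (cmod (F \<xi>))\<^sup>2" for \<xi>
    by (simp only: power_mult_distrib sq[OF pos])
  have b2: "integrable lborel (\<lambda>\<xi>. (?b \<xi>)\<^sup>2)"
    unfolding bsq by (rule F(2))
  note CS = Cauchy_Schwarz_integral[OF a2 b2]
  have int: "integrable lborel (\<lambda>\<xi>. ?a \<xi> * ?b \<xi>)"
    by (rule CS) auto
  have le: "\<bar>\<xi>\<bar> ^ k * cmod (F \<xi>) \<le> ?a \<xi> * ?b \<xi>" for \<xi>
  proof -
    have "\<bar>\<xi>\<bar> \<le> sqrt (1 + \<xi>\<^sup>2)"
      by (intro real_le_rsqrt) simp
    then have "\<bar>\<xi>\<bar> ^ k \<le> sqrt (1 + \<xi>\<^sup>2) ^ k" by (rule power_mono) simp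
    also have "\<dots> = (1 + \<xi>\<^sup>2) powr (real k / 2)"
      using pos[of \<xi>] by (simp add: powr_half_sqrt[symmetric] powr_powr flip: powr_realpow)
    also have "\<dots> = ?a \<xi> * (1 + \<xi>\<^sup>2) powr (s / 2)"
      using pos[of \<xi>] by (simp add: field_simps flip: powr_add)
    finally show ?thesis
      unfolding mult.assoc[symmetric] by (rule mult_right_mono) simp
  qed
  show int': "integrable lborel (\<lambda>\<xi>. \<bar>\<xi>\<bar> ^ k * cmod (fourier (\<lambda>x. complex_of_real (f x)) \<xi>))"
    unfolding F_def[symmetric]
    by (rule Bochner_Integration.integrable_bound[OF int]) (use le in \<open>auto simp: abs_mult intro!: AE_I2\<close>)
  have "(LINT \<xi>|lborel. \<bar>\<xi>\<bar> ^ k * cmod (F \<xi>)) \<le> (LINT \<xi>|lborel. ?a \<xi> * ?b \<xi>)"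
    by (rule integral_mono[OF int'[folded F_def] int le])
  also have "\<dots> \<le> C * sqrt (LINT \<xi>|lborel. (?b \<xi>)\<^sup>2)"
    unfolding C_def by (rule CS) auto
  also have "\<dots> = C * Hs_norm s f"
    by (simp only: bsq Hs_norm_def F_def[symmetric])
  finally show "(LINT \<xi>|lborel. \<bar>\<xi>\<bar> ^ k * cmod (fourier (\<lambda>x. complex_of_real (f x)) \<xi>)) \<le> C * Hs_norm s f"
    unfolding F_def .
qed

section \<open>Differentiation of the inversion integral\<close>

lemma DERIV_integral:
  fixes \<Phi> :: "real \<Rightarrow> 'a \<Rightarrow> real"
  assumes int: "\<And>y. integrable M (\<Phi> y)" and w: "integrable M w"
    and [measurable]: "D \<in> borel_measurable M"
    and deriv: "\<And>\<xi>. DERIV (\<lambda>y. \<Phi> y \<xi>) x :> D \<xi>"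
    and lip: "\<And>y \<xi>. \<bar>\<Phi> y \<xi> - \<Phi> x \<xi>\<bar> \<le> w \<xi> * \<bar>y - x\<bar>"
  shows "DERIV (\<lambda>y. LINT \<xi>|M. \<Phi> y \<xi>) x :> (LINT \<xi>|M. D \<xi>)"
  unfolding has_field_derivative_iff tendsto_at_iff_sequentially comp_def
proof (intro allI impI)
  fix X :: "nat \<Rightarrow> real" assume X: "\<forall>i. X i \<in> UNIV - {x}" "X \<longlonglongrightarrow> x"
  have [measurable]: "\<Phi> y \<in> borel_measurable M" for y using int by auto
  \<comment> \<open>The difference quotients along an arbitrary sequence are dominated by the
    Lipschitz bound \<open>w\<close>.\<close>
  have "(\<lambda>i. LINT \<xi>|M. (\<Phi> (X i) \<xi> - \<Phi> x \<xi>) / (X i - x)) \<longlonglongrightarrow> (LINT \<xi>|M. D \<xi>)"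
  proof (rule integral_dominated_convergence[where w = w])
    show "AE \<xi> in M. (\<lambda>i. (\<Phi> (X i) \<xi> - \<Phi> x \<xi>) / (X i - x)) \<longlonglongrightarrow> D \<xi>"
      using deriv X unfolding has_field_derivative_iff tendsto_at_iff_sequentially comp_def by simp
    show "AE \<xi> in M. norm ((\<Phi> (X i) \<xi> - \<Phi> x \<xi>) / (X i - x)) \<le> w \<xi>" for i
      using X(1) lip by (simp add: divide_le_eq)
  qed (use w in auto)
  moreover have "(LINT \<xi>|M. (\<Phi> (X i) \<xi> - \<Phi> x \<xi>) / (X i - x)) = ((LINT \<xi>|M. \<Phi> (X i) \<xi>) - (LINT \<xi>|M. \<Phi> x \<xi>)) / (X i - x)" for i
    using int by simp
  ultimately show "(\<lambda>i. ((LINT \<xi>|M. \<Phi> (X i) \<xi>) - (LINT \<xi>|M. \<Phi> x \<xi>)) / (X i - x)) \<longlonglongrightarrow> (LINT \<xi>|M. D \<xi>)"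
    by (simp only:)
qed

lemma cmod_cis_diff_le: "cmod (cis a - cis b) \<le> \<bar>a - b\<bar>"
proof -
  have "cis a - cis b = cis b * (cis (a - b) - 1)"
    by (simp add: right_diff_distrib cis_mult)
  moreover have "cmod (cis (a - b) - 1) \<le> \<bar>a - b\<bar>"
    using iexp_approx1[of "a - b" 0] by (simp add: cis_conv_exp)
  ultimately show ?thesis by (simp add: norm_mult)
qed

text \<open>The \<open>k\<close>-th derivative of the inverse Fourier transform, differentiated
  under the integral. The real part keeps the function real-valued, so that real derivatives
  apply.\<close>

definition fourier_synthesis :: "nat \<Rightarrow> (real \<Rightarrow> complex) \<Rightarrow> real \<Rightarrow> real" where
  "fourier_synthesis k F x = (LINT \<xi>|lborel. Re ((\<i> * complex_of_real \<xi>) ^ k * F \<xi> * cis (x * \<xi>))) / (2 * pi)"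

lemma fourier_synthesis_integrable:
  assumes [measurable]: "F \<in> borel_measurable borel" and k: "integrable lborel (\<lambda>\<xi>. \<bar>\<xi>\<bar> ^ k * cmod (F \<xi>))"
  shows "integrable lborel (\<lambda>\<xi>. (\<i> * complex_of_real \<xi>) ^ k * F \<xi> * cis (x * \<xi>))"
  by (rule Bochner_Integration.integrable_bound[OF k]) (auto simp: norm_mult norm_power)

lemma fourier_synthesis_le:
  assumes [measurable]: "F \<in> borel_measurable borel" and k: "integrable lborel (\<lambda>\<xi>. \<bar>\<xi>\<bar> ^ k * cmod (F \<xi>))"
  shows "\<bar>fourier_synthesis k F x\<bar> \<le> (LINT \<xi>|lborel. \<bar>\<xi>\<bar> ^ k * cmod (F \<xi>))"
proof -
  let ?I = "LINT \<xi>|lborel. \<bar>\<xi>\<bar> ^ k * cmod (F \<xi>)"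
  have "\<bar>Re ((\<i> * complex_of_real \<xi>) ^ k * F \<xi> * cis (x * \<xi>))\<bar> \<le> \<bar>\<xi>\<bar> ^ k * cmod (F \<xi>)" for \<xi>
    using abs_Re_le_cmod[of "(\<i> * complex_of_real \<xi>) ^ k * F \<xi> * cis (x * \<xi>)"] by (simp add: norm_mult norm_power)
  then have "\<bar>LINT \<xi>|lborel. Re ((\<i> * complex_of_real \<xi>) ^ k * F \<xi> * cis (x * \<xi>))\<bar> \<le> ?I"
    by (intro integral_abs_bound_integral k integrable_Re fourier_synthesis_integrable) auto
  moreover have "0 \<le> ?I" by (rule integral_nonneg_AE) simp
  moreover have "?I / (2 * pi) \<le> ?I / 1"
    using \<open>0 \<le> ?I\<close> pi_gt3 by (intro divide_left_mono) auto
  moreover have "\<bar>LINT \<xi>|lborel. Re ((\<i> * complex_of_real \<xi>) ^ k * F \<xi> * cis (x * \<xi>))\<bar> / (2 * pi) \<le> ?I / (2 * pi)"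
    by (intro divide_right_mono calculation(1)) simp
  ultimately show ?thesis
    unfolding fourier_synthesis_def abs_divide by simp
qed

text \<open>Since \<open>cis\<close> is 1-Lipschitz, the moment of order \<open>Suc k\<close>
  dominates the difference quotients.\<close>

lemma DERIV_fourier_synthesis:
  assumes [measurable]: "F \<in> borel_measurable borel" and k: "integrable lborel (\<lambda>\<xi>. \<bar>\<xi>\<bar> ^ k * cmod (F \<xi>))"
    and Suc: "integrable lborel (\<lambda>\<xi>. \<bar>\<xi>\<bar> ^ Suc k * cmod (F \<xi>))"
  shows "DERIV (fourier_synthesis k F) x :> fourier_synthesis (Suc k) F x"
proof -
  let ?c = "\<lambda>\<xi>. (\<i> * complex_of_real \<xi>) ^ k * F \<xi>"
  have "DERIV (\<lambda>y. LINT \<xi>|lborel. Re (?c \<xi> * cis (y * \<xi>))) x :> (LINT \<xi>|lborel. Re ((\<i> * complex_of_real \<xi>) ^ Suc k * F \<xi> * cis (x * \<xi>)))"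
  proof (rule DERIV_integral[OF _ Suc])
    show "integrable lborel (\<lambda>\<xi>. Re (?c \<xi> * cis (y * \<xi>)))" for y
      by (intro integrable_Re fourier_synthesis_integrable k) simp
    show "DERIV (\<lambda>y. Re (?c \<xi> * cis (y * \<xi>))) x :> Re ((\<i> * complex_of_real \<xi>) ^ Suc k * F \<xi> * cis (x * \<xi>))" for \<xi>
    proof -
      have "DERIV (\<lambda>y. Re (c * cis (y * \<xi>))) x :> Re (\<i> * complex_of_real \<xi> * c * cis (x * \<xi>))" for c
        unfolding times_complex.sel by (auto intro!: derivative_eq_intros simp: algebra_simps)
      from this[of "?c \<xi>"] show ?thesis by (simp only: power_Suc mult.assoc)
    qed
    show "\<bar>Re (?c \<xi> * cis (y * \<xi>)) - Re (?c \<xi> * cis (x * \<xi>))\<bar> \<le> \<bar>\<xi>\<bar> ^ Suc k * cmod (F \<xi>) * \<bar>y - x\<bar>" for y \<xi>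
    proof -
      have "\<bar>Re (?c \<xi> * cis (y * \<xi>)) - Re (?c \<xi> * cis (x * \<xi>))\<bar> \<le> cmod (?c \<xi> * (cis (y * \<xi>) - cis (x * \<xi>)))"
        using abs_Re_le_cmod[of "?c \<xi> * (cis (y * \<xi>) - cis (x * \<xi>))"] by (simp add: right_diff_distrib)
      also have "\<dots> = \<bar>\<xi>\<bar> ^ k * cmod (F \<xi>) * cmod (cis (y * \<xi>) - cis (x * \<xi>))"
        by (simp add: norm_mult norm_power)
      also have "\<dots> \<le> \<bar>\<xi>\<bar> ^ k * cmod (F \<xi>) * \<bar>y * \<xi> - x * \<xi>\<bar>"
        by (intro mult_left_mono cmod_cis_diff_le) auto
      also have "\<dots> = \<bar>\<xi>\<bar> ^ Suc k * cmod (F \<xi>) * \<bar>y - x\<bar>"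
        by (simp add: left_diff_distrib[symmetric] abs_mult)
      finally show ?thesis .
    qed
  qed measurable
  then show ?thesis
    unfolding fourier_synthesis_def[abs_def] by (rule DERIV_cdivide)
qed

lemma Hs_fourier_synthesis:
  assumes s: "s > 1 / 2" and f: "f \<in> Hs s" and cont: "continuous_on UNIV f"
  shows "f = fourier_synthesis 0 (fourier (\<lambda>x. complex_of_real (f x)))"
proof
  fix x
  define F where "F = fourier (\<lambda>x. complex_of_real (f x))"
  note F = Hs_fourier[OF f, folded F_def]
  have [measurable]: "F \<in> borel_measurable borel"
    using F(1) by (auto simp: has_fourier_transform_def square_integrable_def)
  have "integrable lborel (\<lambda>\<xi>. \<bar>\<xi>\<bar> ^ 0 * cmod (F \<xi>))"
    using Hs_moment[of 0 s] s f by (auto simp: F_def)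
  then have int: "integrable lborel F"
    by (simp add: integrable_norm_iff)
  have "complex_of_real (f x) = (LINT \<xi>|lborel. F \<xi> * cis (x * \<xi>)) / complex_of_real (2 * pi)"
    by (rule fourier_inversion[OF F(1) _ int]) (intro continuous_intros cont)
  then have "f x = Re ((LINT \<xi>|lborel. F \<xi> * cis (x * \<xi>)) / complex_of_real (2 * pi))"
    by (metis Re_complex_of_real)
  also have "\<dots> = Re (LINT \<xi>|lborel. F \<xi> * cis (x * \<xi>)) / (2 * pi)"
    by (rule Re_divide_of_real)
  also have "Re (LINT \<xi>|lborel. F \<xi> * cis (x * \<xi>)) = (LINT \<xi>|lborel. Re (F \<xi> * cis (x * \<xi>)))"
    by (intro integral_Re[symmetric] Bochner_Integration.integrable_bound[OF int]) (auto simp: norm_mult)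
  finally show "f x = fourier_synthesis 0 (fourier (\<lambda>x. complex_of_real (f x))) x"
    by (simp add: fourier_synthesis_def F_def)
qed

text \<open>The inversion formula bounds \<open>f\<close> by the integral of its transform, hence by
  the moment of order zero. The constant is chosen before \<open>f\<close>, so that differences and
  difference quotients in time can be inserted later.\<close>

lemma Hs_sup_bound:
  assumes s: "s > 1 / 2"
  shows "\<exists>C\<ge>0. \<forall>f\<in>Hs s. continuous_on UNIV f \<longrightarrow> (\<forall>x. \<bar>f x\<bar> \<le> C * Hs_norm s f)"
proof -
  obtain C where C: "C \<ge> 0" "\<And>f. f \<in> Hs s \<Longrightarrow> integrable lborel (\<lambda>\<xi>. \<bar>\<xi>\<bar> ^ 0 * cmod (fourier (\<lambda>x. complex_of_real (f x)) \<xi>)) \<and>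
     (LINT \<xi>|lborel. \<bar>\<xi>\<bar> ^ 0 * cmod (fourier (\<lambda>x. complex_of_real (f x)) \<xi>)) \<le> C * Hs_norm s f"
    using Hs_moment[of 0 s] s by auto
  show ?thesis
  proof (intro exI[of _ C] conjI ballI impI allI C(1))
    fix f x assume f: "f \<in> Hs s" "continuous_on UNIV f"
    have "\<bar>f x\<bar> = \<bar>fourier_synthesis 0 (fourier (\<lambda>x. complex_of_real (f x))) x\<bar>"
      using Hs_fourier_synthesis[OF s f] by metis
    also have "\<dots> \<le> (LINT \<xi>|lborel. \<bar>\<xi>\<bar> ^ 0 * cmod (fourier (\<lambda>x. complex_of_real (f x)) \<xi>))"
      using Hs_fourier(1)[OF f(1)] C(2)[OF f(1)]
      by (intro fourier_synthesis_le) (auto simp: has_fourier_transform_def square_integrable_def)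
    finally show "\<bar>f x\<bar> \<le> C * Hs_norm s f"
      using C(2)[OF f(1)] by linarith
  qed
qed

lemma Hs_has_deriv:
  assumes s: "s > 3 / 2" and f: "f \<in> Hs s" "continuous_on UNIV f"
  shows "DERIV f x :> fourier_synthesis 1 (fourier (\<lambda>x. complex_of_real (f x))) x"
proof -
  have "DERIV (fourier_synthesis 0 (fourier (\<lambda>x. complex_of_real (f x)))) x :> fourier_synthesis (Suc 0) (fourier (\<lambda>x. complex_of_real (f x))) x"
    using Hs_fourier(1)[OF f(1)] Hs_moment[of 0 s] Hs_moment[of 1 s] s f(1)
    by (intro DERIV_fourier_synthesis) (auto simp: has_fourier_transform_def square_integrable_def)
  moreover have "f = fourier_synthesis 0 (fourier (\<lambda>x. complex_of_real (f x)))"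
    using s by (intro Hs_fourier_synthesis[OF _ f]) simp
  ultimately show ?thesis by simp
qed

lemma Hs_differentiable:
  assumes "s > 3 / 2" "f \<in> Hs s" "continuous_on UNIV f"
  shows "DERIV f x :> deriv f x"
  using Hs_has_deriv[OF assms] DERIV_imp_deriv by metis

text \<open>Each derivative costs one more moment of the transform; the second moment is covered by
  \<open>Hs_moment\<close> for s > 2 + 1/2.\<close>

lemma Hs_deriv_differentiable:
  assumes s: "s > 5 / 2" and f: "f \<in> Hs s" "continuous_on UNIV f"
  shows "DERIV (deriv f) x :> deriv (deriv f) x"
proof -
  have 1: "deriv f = fourier_synthesis 1 (fourier (\<lambda>x. complex_of_real (f x)))"
    using s Hs_has_deriv[OF _ f, THEN DERIV_imp_deriv] by (intro ext) auto
  have "DERIV (fourier_synthesis 1 (fourier (\<lambda>x. complex_of_real (f x)))) x :> fourier_synthesis (Suc 1) (fourier (\<lambda>x. complex_of_real (f x))) x"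
    using Hs_fourier(1)[OF f(1)] Hs_moment[of 1 s] Hs_moment[of 2 s] s f(1)
    by (intro DERIV_fourier_synthesis) (auto simp: has_fourier_transform_def square_integrable_def numeral_2_eq_2)
  then show ?thesis unfolding 1 using DERIV_imp_deriv by metis
qed

lemma Hs_deriv_sup_bound:
  assumes s: "s > 3 / 2"
  shows "\<exists>C\<ge>0. \<forall>f\<in>Hs s. continuous_on UNIV f \<longrightarrow> (\<forall>x. \<bar>deriv f x\<bar> \<le> C * Hs_norm s f)"
proof -
  obtain C where C: "C \<ge> 0" "\<And>f. f \<in> Hs s \<Longrightarrow> integrable lborel (\<lambda>\<xi>. \<bar>\<xi>\<bar> ^ 1 * cmod (fourier (\<lambda>x. complex_of_real (f x)) \<xi>)) \<and>
     (LINT \<xi>|lborel. \<bar>\<xi>\<bar> ^ 1 * cmod (fourier (\<lambda>x. complex_of_real (f x)) \<xi>)) \<le> C * Hs_norm s f"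
    using Hs_moment[of 1 s] s by auto
  show ?thesis
  proof (intro exI[of _ C] conjI ballI impI allI C(1))
    fix f x assume f: "f \<in> Hs s" "continuous_on UNIV f"
    have "\<bar>deriv f x\<bar> = \<bar>fourier_synthesis 1 (fourier (\<lambda>x. complex_of_real (f x))) x\<bar>"
      using DERIV_imp_deriv[OF Hs_has_deriv[OF s f]] by simp
    also have "\<dots> \<le> (LINT \<xi>|lborel. \<bar>\<xi>\<bar> ^ 1 * cmod (fourier (\<lambda>x. complex_of_real (f x)) \<xi>))"
      using Hs_fourier(1)[OF f(1)] C(2)[OF f(1)]
      by (intro fourier_synthesis_le) (auto simp: has_fourier_transform_def square_integrable_def)
    finally show "\<bar>deriv f x\<bar> \<le> C * Hs_norm s f"
      using C(2)[OF f(1)] by linarith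
  qed
qed

section \<open>Convolution with the Green function\<close>

lemma DERIV_set_integral_atMost:
  fixes g :: "real \<Rightarrow> real"
  assumes cont: "continuous_on UNIV g" and int: "\<And>x. set_integrable lborel {..x} g"
  shows "DERIV (\<lambda>x. LINT y:{..x}|lborel. g y) x :> g x"
proof -
  \<comment> \<open>The integral is cut at \<open>x - 1\<close>: the unbounded piece does not depend
    on \<open>u\<close>, and the compact piece is covered by the fundamental theorem of
    calculus.\<close>
  have eq: "(LINT y:{..u}|lborel. g y) = (LINT y:{..<x - 1}|lborel. g y) + integral {x - 1..u} g"
    if u: "u \<in> {x - 1<..<x + 1}" for u
  proof -
    have U: "{..u} = {..<x - 1} \<union> {x - 1..u}" using u by auto
    have ints: "set_integrable lborel {..<x - 1} g" "set_integrable lborel {x - 1..u} g"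
      using int[of u] u by (auto elim!: set_integrable_subset)
    have "(LINT y:{..u}|lborel. g y) = (LINT y:{..<x - 1}|lborel. g y) + (LINT y:{x - 1..u}|lborel. g y)"
      unfolding U by (rule set_integral_Un) (use ints in auto)
    then show ?thesis
      using set_borel_integral_eq_integral(2)[OF ints(2)] by simp
  qed
  have "((\<lambda>u. integral {x - 1..u} g) has_real_derivative g x) (at x within {x - 1..x + 1})"
    by (rule integral_has_real_derivative) (auto intro: continuous_on_subset[OF cont])
  then have "DERIV (\<lambda>u. (LINT y:{..<x - 1}|lborel. g y) + integral {x - 1..u} g) x :> g x"
    by (auto intro!: derivative_eq_intros simp: at_within_Icc_at)
  then show ?thesis
    by (rule has_field_derivative_transform_within_open[of _ _ _ "{x - 1<..<x + 1}"]) (auto simp: eq)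
qed

lemma set_integral_atLeast_eq_atMost:
  fixes g :: "real \<Rightarrow> real"
  shows "(LINT y:{x..}|lborel. g y) = (LINT y:{..- x}|lborel. g (- y))"
  unfolding set_lebesgue_integral_def
  by (subst lborel_integral_real_affine[where c = "- 1" and t = 0])
     (auto intro!: Bochner_Integration.integral_cong simp: indicator_def)

lemma set_integrable_atLeast_iff_atMost:
  fixes g :: "real \<Rightarrow> real"
  shows "set_integrable lborel {x..} g \<longleftrightarrow> set_integrable lborel {..- x} (\<lambda>y. g (- y))"
  unfolding set_integrable_def
  by (subst lborel_integrable_real_affine_iff[where c = "- 1" and t = 0, symmetric], simp,
      intro arg_cong[where f = "integrable lborel"]) (auto simp: indicator_def)

text \<open>Reflection reduces this to the left half-line; the minus sign comes from the chain
  rule.\<close>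

lemma DERIV_set_integral_atLeast:
  fixes g :: "real \<Rightarrow> real"
  assumes cont: "continuous_on UNIV g" and int: "\<And>x. set_integrable lborel {x..} g"
  shows "DERIV (\<lambda>x. LINT y:{x..}|lborel. g y) x :> - g x"
proof -
  have "DERIV (\<lambda>x. LINT y:{..x}|lborel. g (- y)) (- x) :> g (- (- x))"
  proof (rule DERIV_set_integral_atMost)
    show "continuous_on UNIV (\<lambda>y. g (- y))"
      by (intro continuous_on_compose2[OF cont] continuous_intros) auto
    show "set_integrable lborel {..x} (\<lambda>y. g (- y))" for x
      using int[of "- x"] by (simp add: set_integrable_atLeast_iff_atMost)
  qed
  then have "DERIV (\<lambda>x. LINT y:{..- x}|lborel. g (- y)) x :> g (- (- x)) * (- 1)"
    by (rule DERIV_chain2) (auto intro!: derivative_eq_intros)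
  then show ?thesis
    by (simp add: set_integral_atLeast_eq_atMost)
qed

section \<open>The Green function and the derivatives of its convolutions\<close>

lemma integrable_G: "integrable lborel (\<lambda>y. G (x - y))"
proof -
  have "integrable lborel G"
    using integrable_exp_minus_abs[of 1] by (simp add: G_def[abs_def])
  from lborel_integrable_real_affine[OF this, of "- 1" x] show ?thesis by simp
qed

lemma G_nonneg: "0 \<le> G x" by (simp add: G_def)

lemma G_measurable [measurable]: "G \<in> borel_measurable borel"
  unfolding G_def[abs_def] by measurable

text \<open>The two coefficients cover both uses: a = b = 1/2 is \<open>G * f\<close>, and a = -1/2,
  b = 1/2 is its derivative, where the terms in \<open>c\<close> no longer cancel and leave
  \<open>- c\<close>.\<close>

lemma DERIV_exp_combination:
  assumes "DERIV P x :> exp x * c" "DERIV Q x :> - (exp (- x) * c)"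
  shows "DERIV (\<lambda>x. a * exp (- x) * P x + b * exp x * Q x) x
    :> a * (c - exp (- x) * P x) + b * (exp x * Q x - c)"
  by (rule derivative_eq_intros assms refl)+ (simp add: algebra_simps flip: exp_add)

context
  fixes f :: "real \<Rightarrow> real" and K :: real
  assumes cont: "continuous_on UNIV f" and bound: "\<And>x. \<bar>f x\<bar> \<le> K"
begin

lemma integrable_G_mult: "integrable lborel (\<lambda>y. G (x - y) * f y)"
proof (rule Bochner_Integration.integrable_bound)
  have [measurable]: "f \<in> borel_measurable borel" 
    by (rule borel_measurable_continuous_onI[OF cont])
  show "integrable lborel (\<lambda>y. G (x - y) * K)"
    using integrable_G by (intro integrable_mult_left) auto
  show "(\<lambda>y. G (x - y) * f y) \<in> borel_measurable lborel" by measurable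
  show "AE y in lborel. norm (G (x - y) * f y) \<le> norm (G (x - y) * K)"
    using bound by (auto simp: abs_mult intro!: mult_left_mono order_trans[OF bound])
qed

text \<open>On each side of \<open>x\<close> the kernel \<open>G (x - y)\<close> factors into a
  function of \<open>x\<close> and a function of \<open>y\<close>, so these integrands are multiples
  of restrictions of the convolution integrand.\<close>

lemma set_integrable_halves:
  "set_integrable lborel {..x} (\<lambda>y. exp y * f y)" "set_integrable lborel {x..} (\<lambda>y. exp (- y) * f y)"
proof -
  have "integrable lborel (\<lambda>y. 2 * exp x * (indicator {..x} y *\<^sub>R (G (x - y) * f y)))"
       "integrable lborel (\<lambda>y. 2 * exp (- x) * (indicator {x..} y *\<^sub>R (G (x - y) * f y)))"
    by (intro integrable_mult_right integrable_mult_indicator integrable_G_mult, simp)+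
  moreover have "2 * exp x * (indicator {..x} y *\<^sub>R (G (x - y) * f y)) = indicator {..x} y *\<^sub>R (exp y * f y)"
      "2 * exp (- x) * (indicator {x..} y *\<^sub>R (G (x - y) * f y)) = indicator {x..} y *\<^sub>R (exp (- y) * f y)" for y
    by (auto simp: indicator_def G_def simp flip: exp_add)
  ultimately show "set_integrable lborel {..x} (\<lambda>y. exp y * f y)" "set_integrable lborel {x..} (\<lambda>y. exp (- y) * f y)"
    unfolding set_integrable_def by (simp_all only:)
qed

lemma convolution_G_split:
  "convolution G f x = 1 / 2 * exp (- x) * (LINT y:{..x}|lborel. exp y * f y) + 1 / 2 * exp x * (LINT y:{x..}|lborel. exp (- y) * f y)"
proof -
  have [measurable]: "f \<in> borel_measurable borel" 
    by (rule borel_measurable_continuous_onI[OF cont])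
  have "convolution G f x = (LINT y|lborel. 1 / 2 * exp (- x) * (indicator {..x} y *\<^sub>R (exp y * f y)) + 1 / 2 * exp x * (indicator {x..} y *\<^sub>R (exp (- y) * f y)))"
    unfolding Defs.convolution_def
  proof (rule integral_cong_AE)
    \<comment> \<open>The two half-lines overlap in the single point \<open>x\<close>, where the
      identity may fail; this is a null set.\<close>
    show "AE y in lborel. G (x - y) * f y = 1 / 2 * exp (- x) * (indicator {..x} y *\<^sub>R (exp y * f y)) + 1 / 2 * exp x * (indicator {x..} y *\<^sub>R (exp (- y) * f y))"
      using AE_lborel_singleton[of x]
    proof eventually_elim
      case (elim y)
      then show ?case by (auto simp: G_def indicator_def exp_diff exp_minus field_simps)
    qed
  qed measurable
  also have "\<dots> = 1 / 2 * exp (- x) * (LINT y:{..x}|lborel. exp y * f y) + 1 / 2 * exp x * (LINT y:{x..}|lborel. exp (- y) * f y)"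
    unfolding set_lebesgue_integral_def
    by (subst Bochner_Integration.integral_add,
        (intro integrable_mult_right set_integrable_halves[unfolded set_integrable_def])+,
        subst (1 2) integral_mult_right_zero, rule refl)
  finally show ?thesis .
qed

lemma DERIV_halves:
  "DERIV (\<lambda>x. LINT y:{..x}|lborel. exp y * f y) x :> exp x * f x"
  "DERIV (\<lambda>x. LINT y:{x..}|lborel. exp (- y) * f y) x :> - (exp (- x) * f x)"
  by (intro DERIV_set_integral_atMost DERIV_set_integral_atLeast set_integrable_halves continuous_intros cont)+

lemma deriv_convolution_G:
  "deriv (convolution G f) x = - 1 / 2 * exp (- x) * (LINT y:{..x}|lborel. exp y * f y) + 1 / 2 * exp x * (LINT y:{x..}|lborel. exp (- y) * f y)"
  and DERIV_convolution_G: "DERIV (convolution G f) x :> deriv (convolution G f) x"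
proof -
  have "DERIV (convolution G f) x :> - 1 / 2 * exp (- x) * (LINT y:{..x}|lborel. exp y * f y) + 1 / 2 * exp x * (LINT y:{x..}|lborel. exp (- y) * f y)"
    unfolding convolution_G_split[abs_def]
    by (rule DERIV_cong[OF DERIV_exp_combination[OF DERIV_halves]]) (simp add: field_simps)
  then show "deriv (convolution G f) x = - 1 / 2 * exp (- x) * (LINT y:{..x}|lborel. exp y * f y) + 1 / 2 * exp x * (LINT y:{x..}|lborel. exp (- y) * f y)"
    and "DERIV (convolution G f) x :> deriv (convolution G f) x"
    using DERIV_imp_deriv by metis+
qed

text \<open>\<open>G\<close> is the fundamental solution of 1 - \<partial>_x^2; the term
  \<open>- f x\<close> comes from the jump of its derivative at the origin.\<close>

lemma DERIV_deriv_convolution_G: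
  "DERIV (deriv (convolution G f)) x :> convolution G f x - f x"
proof -
  have "deriv (convolution G f) = (\<lambda>x. - 1 / 2 * exp (- x) * (LINT y:{..x}|lborel. exp y * f y) + 1 / 2 * exp x * (LINT y:{x..}|lborel. exp (- y) * f y))"
    by (rule ext) (rule deriv_convolution_G)
  then show ?thesis
    unfolding convolution_G_split
    by (simp only:) (rule DERIV_cong[OF DERIV_exp_combination[OF DERIV_halves]], simp add: field_simps)
qed

end

text \<open>The formulas for \<open>G * f\<close> and its derivative differ only in the sign of the
  left half, so estimating both halves separately gives the same bound.\<close>

lemma convolution_G_le:
  assumes cont: "continuous_on UNIV f" and bound: "\<And>x. \<bar>f x\<bar> \<le> K"
  shows "\<bar>convolution G f x\<bar> \<le> convolution G (\<lambda>y. \<bar>f y\<bar>) x"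
    and "\<bar>deriv (convolution G f) x\<bar> \<le> convolution G (\<lambda>y. \<bar>f y\<bar>) x"
proof -
  let ?A = "\<lambda>f. LINT y:{..x}|lborel. exp y * f y" and ?B = "\<lambda>f. LINT y:{x..}|lborel. exp (- y) * f y"
  have cont': "continuous_on UNIV (\<lambda>y. \<bar>f y\<bar>)" by (intro continuous_intros cont)
  have bound': "\<bar>\<bar>f y\<bar>\<bar> \<le> K" for y using bound by simp
  have A: "\<bar>?A f\<bar> \<le> ?A (\<lambda>y. \<bar>f y\<bar>)" and B: "\<bar>?B f\<bar> \<le> ?B (\<lambda>y. \<bar>f y\<bar>)"
    using set_integral_norm_bound[OF set_integrable_halves(1)[OF cont bound]]
      set_integral_norm_bound[OF set_integrable_halves(2)[OF cont bound]] by (simp_all add: abs_mult)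
  have "\<bar>1 / 2 * exp (- x) * ?A f\<bar> \<le> 1 / 2 * exp (- x) * ?A (\<lambda>y. \<bar>f y\<bar>)" "\<bar>1 / 2 * exp x * ?B f\<bar> \<le> 1 / 2 * exp x * ?B (\<lambda>y. \<bar>f y\<bar>)"
    using A B by (auto simp: abs_mult)
  then show "\<bar>convolution G f x\<bar> \<le> convolution G (\<lambda>y. \<bar>f y\<bar>) x"
    and "\<bar>deriv (convolution G f) x\<bar> \<le> convolution G (\<lambda>y. \<bar>f y\<bar>) x"
    unfolding convolution_G_split[OF cont bound] convolution_G_split[OF cont' bound'] deriv_convolution_G[OF cont bound]
    by linarith+
qed

text \<open>A shift by \<open>z\<close> changes the weight by at most the factor
  \<open>exp (\<beta> * \<bar>z\<bar>)\<close>. Against \<open>G\<close> this leaves half of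
  \<open>exp (- (1 - \<beta>) * \<bar>z\<bar>)\<close>, integrable for \<beta> < 1. The resulting
  constant depends on the weight only through \<beta>.\<close>

lemma convolution_G_abs_le_weight:
  assumes cont: "continuous_on UNIV f" and bound: "\<And>x. \<bar>f x\<bar> \<le> K"
    and \<beta>: "\<beta> < 1" and \<sigma>: "\<And>x z. \<sigma> (x - z) \<le> exp (\<beta> * \<bar>z\<bar>) * \<sigma> x"
    and f: "\<And>y. \<bar>f y\<bar> \<le> c * \<sigma> y" and c: "0 \<le> c"
  shows "convolution G (\<lambda>y. \<bar>f y\<bar>) x \<le> (LINT z|lborel. exp (- (1 - \<beta>) * \<bar>z\<bar>)) / 2 * (c * \<sigma> x)"
proof -
  have cont': "continuous_on UNIV (\<lambda>y. \<bar>f y\<bar>)" by (intro continuous_intros cont)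
  have bound': "\<bar>\<bar>f y\<bar>\<bar> \<le> K" for y using bound by simp
  have "integrable lborel (\<lambda>z::real. exp (- (1 - \<beta>) * \<bar>z\<bar>))"
    using \<beta> by (intro integrable_exp_minus_abs) simp
  then have int: "integrable lborel (\<lambda>z. exp (- (1 - \<beta>) * \<bar>z\<bar>) / 2 * (c * \<sigma> x))"
    by (intro integrable_mult_left integrable_divide)
  have "convolution G (\<lambda>y. \<bar>f y\<bar>) x = (LINT z|lborel. G z * \<bar>f (x - z)\<bar>)"
    unfolding Defs.convolution_def by (subst lborel_integral_real_affine[where c = "- 1" and t = x]) auto
  also have "\<dots> \<le> (LINT z|lborel. exp (- (1 - \<beta>) * \<bar>z\<bar>) / 2 * (c * \<sigma> x))"
  proof (rule integral_mono[OF _ int])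
    show "integrable lborel (\<lambda>z. G z * \<bar>f (x - z)\<bar>)"
      using lborel_integrable_real_affine[OF integrable_G_mult[OF cont' bound', of x], of "- 1" x] by simp
    fix z
    have "\<bar>f (x - z)\<bar> \<le> c * (exp (\<beta> * \<bar>z\<bar>) * \<sigma> x)"
      using f[of "x - z"] mult_left_mono[OF \<sigma>[of x z] c] by linarith
    then have "G z * \<bar>f (x - z)\<bar> \<le> G z * (c * (exp (\<beta> * \<bar>z\<bar>) * \<sigma> x))"
      by (rule mult_left_mono) (rule G_nonneg)
    also have "\<dots> = (exp (- \<bar>z\<bar>) * exp (\<beta> * \<bar>z\<bar>)) / 2 * (c * \<sigma> x)"
      by (simp add: G_def)
    also have "exp (- \<bar>z\<bar>) * exp (\<beta> * \<bar>z\<bar>) = exp (- (1 - \<beta>) * \<bar>z\<bar>)"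
      by (simp add: algebra_simps flip: exp_add)
    finally show "G z * \<bar>f (x - z)\<bar> \<le> exp (- (1 - \<beta>) * \<bar>z\<bar>) / 2 * (c * \<sigma> x)" .
  qed
  also have "\<dots> = (LINT z|lborel. exp (- (1 - \<beta>) * \<bar>z\<bar>)) / 2 * (c * \<sigma> x)"
    by (simp only: integral_mult_left_zero integral_divide_zero)
  finally show ?thesis .
qed

text \<open>From -|x - y| \<le> y - x the kernel is at most \<open>exp (- x) / 2 * exp y\<close>,
  and the assumption makes \<open>exp y * \<bar>f y\<bar>\<close> integrable over the whole
  line.\<close>

lemma convolution_G_abs_le_exp:
  assumes cont: "continuous_on UNIV f" and bound: "\<And>x. \<bar>f x\<bar> \<le> K" and a: "0 < a"
    and f: "\<And>y. exp y * \<bar>f y\<bar> \<le> c * exp (- a * \<bar>y\<bar>)"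
  shows "convolution G (\<lambda>y. \<bar>f y\<bar>) x \<le> c * (LINT z|lborel. exp (- a * \<bar>z\<bar>)) / 2 * exp (- x)"
proof -
  have cont': "continuous_on UNIV (\<lambda>y. \<bar>f y\<bar>)" by (intro continuous_intros cont)
  have bound': "\<bar>\<bar>f y\<bar>\<bar> \<le> K" for y using bound by simp
  have "convolution G (\<lambda>y. \<bar>f y\<bar>) x \<le> (LINT y|lborel. exp (- x) / 2 * c * exp (- a * \<bar>y\<bar>))"
    unfolding Defs.convolution_def
  proof (rule integral_mono[OF integrable_G_mult[OF cont' bound']])
    show "integrable lborel (\<lambda>y. exp (- x) / 2 * c * exp (- a * \<bar>y\<bar>))"
      by (intro integrable_mult_right integrable_exp_minus_abs a)
    fix y
    have "G (x - y) \<le> exp (- x) / 2 * exp y"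
      by (simp add: G_def flip: exp_add)
    then have "G (x - y) * \<bar>f y\<bar> \<le> exp (- x) / 2 * exp y * \<bar>f y\<bar>"
      by (rule mult_right_mono) simp
    also have "\<dots> \<le> exp (- x) / 2 * (c * exp (- a * \<bar>y\<bar>))"
      unfolding mult.assoc[of _ "exp y"] by (intro mult_left_mono f) simp
    finally show "G (x - y) * \<bar>f y\<bar> \<le> exp (- x) / 2 * c * exp (- a * \<bar>y\<bar>)" by (simp only: mult.assoc)
  qed
  also have "\<dots> = exp (- x) / 2 * c * (LINT z|lborel. exp (- a * \<bar>z\<bar>))"
    by (rule integral_mult_right_zero)
  finally show ?thesis by (simp add: mult_ac)
qed

section \<open>Propagation of exponential decay\<close>

text \<open>What the decay argument uses of a strong solution, with \<open>w\<close> and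
  \<open>v\<close> for u_x and u_xx. The time derivatives come from the equation and its space
  derivative after replacing the second derivative of \<open>G * g\<close> by
  \<open>G * g - g\<close>; both are arranged to show the common transport speed u^2 - w^2.\<close>

locale smooth_solution =
  fixes u w v :: "real \<Rightarrow> real \<Rightarrow> real" and T M :: real
  assumes T: "0 < T"
    and DERIV_u: "\<And>t x. t \<in> {0..T} \<Longrightarrow> DERIV (u t) x :> w t x"
    and DERIV_w: "\<And>t x. t \<in> {0..T} \<Longrightarrow> DERIV (w t) x :> v t x"
    and u_le: "\<And>t x. t \<in> {0..T} \<Longrightarrow> \<bar>u t x\<bar> \<le> M"
    and w_le: "\<And>t x. t \<in> {0..T} \<Longrightarrow> \<bar>w t x\<bar> \<le> M"
    and cont_u: "continuous_on ({0..T} \<times> UNIV) (\<lambda>(t, x). u t x)"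
    and cont_w: "continuous_on ({0..T} \<times> UNIV) (\<lambda>(t, x). w t x)"
    and u_t: "\<And>t x. t \<in> {0..T} \<Longrightarrow> ((\<lambda>\<tau>. u \<tau> x) has_real_derivative
        - (((u t x)\<^sup>2 - (w t x)\<^sup>2) * w t x) - 2/3 * (w t x)^3
        - deriv (convolution G (\<lambda>y. 2/3 * (u t y)^3 + u t y * (w t y)\<^sup>2)) x
        - 1/3 * convolution G (\<lambda>y. (w t y)^3) x) (at t within {0..T})"
    and w_t: "\<And>t x. t \<in> {0..T} \<Longrightarrow> ((\<lambda>\<tau>. w \<tau> x) has_real_derivative
        - (((u t x)\<^sup>2 - (w t x)\<^sup>2) * v t x) - u t x * (w t x)\<^sup>2 + 2/3 * (u t x)^3
        - convolution G (\<lambda>y. 2/3 * (u t y)^3 + u t y * (w t y)\<^sup>2) x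
        - 1/3 * deriv (convolution G (\<lambda>y. (w t y)^3)) x) (at t within {0..T})"

text \<open>Left difference quotients at the maximum are nonnegative. Using only these includes a
  maximum at the final time \<open>T\<close>, and \<open>0 < t\<close> ensures that they
  exist.\<close>

lemma has_real_derivative_nonneg_at_max:
  fixes f :: "real \<Rightarrow> real"
  assumes D: "(f has_real_derivative D) (at t within {0..T})" and t: "0 < t" "t \<le> T"
    and max: "\<And>\<tau>. \<tau> \<in> {0..T} \<Longrightarrow> f \<tau> \<le> f t"
  shows "0 \<le> D"
proof -
  have "((\<lambda>\<tau>. (f \<tau> - f t) / (\<tau> - t)) \<longlongrightarrow> D) (at t within {0..<t})"
    using D t unfolding has_field_derivative_iff by (auto elim!: tendsto_within_subset)
  moreover have "\<forall>\<^sub>F \<tau> in at t within {0..<t}. 0 \<le> (f \<tau> - f t) / (\<tau> - t)"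
    using max t by (auto simp: eventually_at_filter intro!: always_eventually divide_nonpos_neg)
  moreover have "at t within {0..<t} \<noteq> bot"
    using t by (simp add: trivial_limit_within islimpt_in_closure)
  ultimately show ?thesis
    by (intro tendsto_lowerbound)
qed

text \<open>Two factors are bounded by \<open>M\<close> and one by \<open>S\<close>. With
  \<open>S\<close> a multiple of the weight the sources become linear in the quantity to be
  estimated; with \<open>S = M\<close> the bounds are purely cubic.\<close>

lemma cubic_le:
  fixes a b M S :: real
  assumes "\<bar>a\<bar> \<le> M" "\<bar>b\<bar> \<le> M" "\<bar>a\<bar> \<le> S" "\<bar>b\<bar> \<le> S"
  shows "\<bar>2/3 * a^3 + a * b\<^sup>2\<bar> \<le> 5/3 * M\<^sup>2 * S" "\<bar>b^3\<bar> \<le> M\<^sup>2 * S"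
proof -
  have M: "a\<^sup>2 \<le> M\<^sup>2" "b\<^sup>2 \<le> M\<^sup>2"
    using assms(1,2) by (simp_all add: abs_le_square_iff[symmetric])
  have "a\<^sup>2 * \<bar>a\<bar> \<le> M\<^sup>2 * S" "b\<^sup>2 * \<bar>a\<bar> \<le> M\<^sup>2 * S" "b\<^sup>2 * \<bar>b\<bar> \<le> M\<^sup>2 * S"
    using M assms(3,4) by (auto intro!: mult_mono)
  moreover have "\<bar>a^3\<bar> = a\<^sup>2 * \<bar>a\<bar>" "\<bar>a * b\<^sup>2\<bar> = b\<^sup>2 * \<bar>a\<bar>" "\<bar>b^3\<bar> = b\<^sup>2 * \<bar>b\<bar>"
    by (simp_all add: abs_mult power3_eq_cube power2_eq_square)
  ultimately show "\<bar>2/3 * a^3 + a * b\<^sup>2\<bar> \<le> 5/3 * M\<^sup>2 * S" "\<bar>b^3\<bar> \<le> M\<^sup>2 * S"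
    by linarith+
qed

text \<open>Here \<open>a\<close>, \<open>b\<close>, \<open>c\<close> stand for \<open>u\<close>, \<open>u\<^sub>x\<close>, \<open>u\<^sub>x\<^sub>x\<close> at a point, \<open>p\<close>, \<open>p'\<close>, \<open>q\<close>, \<open>q'\<close> for the nonlocal terms,
  and \<open>e\<close>, \<open>d\<close> for the time and space derivatives of \<open>u\<^sup>2 + u\<^sub>x\<^sup>2\<close>.\<close>

lemma energy_rate_le:
  fixes a b c d p p' q q' M J \<beta> :: real
  assumes a: "\<bar>a\<bar> \<le> M" and b: "\<bar>b\<bar> \<le> M" and d: "d = 2 * a * b + 2 * b * c" "\<bar>d\<bar> \<le> 2 * \<beta> * (a\<^sup>2 + b\<^sup>2)"
    and p: "\<bar>p\<bar> \<le> J * (5/3 * M\<^sup>2 * sqrt (a\<^sup>2 + b\<^sup>2))" "\<bar>p'\<bar> \<le> J * (5/3 * M\<^sup>2 * sqrt (a\<^sup>2 + b\<^sup>2))"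
    and q: "\<bar>q\<bar> \<le> J * (M\<^sup>2 * sqrt (a\<^sup>2 + b\<^sup>2))" "\<bar>q'\<bar> \<le> J * (M\<^sup>2 * sqrt (a\<^sup>2 + b\<^sup>2))"
    and e: "e = 2 * a * (- ((a\<^sup>2 - b\<^sup>2) * b) - 2/3 * b^3 - p' - 1/3 * q)
         + 2 * b * (- ((a\<^sup>2 - b\<^sup>2) * c) - a * b\<^sup>2 + 2/3 * a^3 - p - 1/3 * q')"
  shows "e \<le> (2 * \<beta> + 14/3 + 8 * J) * M\<^sup>2 * (a\<^sup>2 + b\<^sup>2)"
proof -
  define E where "E = a\<^sup>2 + b\<^sup>2"
  define S where "S = sqrt E"
  have E: "0 \<le> E" and S: "S * S = E" by (simp_all add: E_def S_def)
  have aS: "\<bar>a\<bar> \<le> S" and bS: "\<bar>b\<bar> \<le> S"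
    by (simp_all add: S_def E_def real_le_rsqrt)
  have S0: "0 \<le> S" by (simp add: S_def E_def)
  have M2: "a\<^sup>2 \<le> M\<^sup>2" "b\<^sup>2 \<le> M\<^sup>2"
    using a b by (simp_all add: abs_le_square_iff[symmetric])
  have prod: "\<bar>x * y\<bar> \<le> S * z" if "\<bar>x\<bar> \<le> S" "\<bar>y\<bar> \<le> z" for x y z
    unfolding abs_mult using that S0 by (intro mult_mono) auto
  \<comment> \<open>The second space derivative \<open>c\<close> enters only through
    \<open>d\<close>, for which a bound is assumed. The remaining coefficients add up to 10/3 + 4/3
    = 14/3 for the local terms and 2 * 5/3 + 2 * 5/3 + 2/3 + 2/3 = 8 for the nonlocal ones.\<close>
  have eq: "e = - ((a\<^sup>2 - b\<^sup>2) * d) - (10/3) * ((a * b) * b\<^sup>2) + (4/3) * ((a * b) * a\<^sup>2)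
      - 2 * (a * p') - (2/3) * (a * q) - 2 * (b * p) - (2/3) * (b * q')"
    unfolding e d(1) by (simp add: power2_eq_square power3_eq_cube algebra_simps)
  have "\<bar>a\<^sup>2 - b\<^sup>2\<bar> \<le> M\<^sup>2" using M2 zero_le_power2[of a] zero_le_power2[of b] by linarith
  then have "\<bar>(a\<^sup>2 - b\<^sup>2) * d\<bar> \<le> M\<^sup>2 * (2 * \<beta> * E)"
    unfolding abs_mult using d(2) by (intro mult_mono) (auto simp: E_def)
  moreover have ab: "\<bar>a * b\<bar> \<le> E"
    unfolding abs_mult S[symmetric] using aS bS S0 by (intro mult_mono) auto
  have "\<bar>(a * b) * b\<^sup>2\<bar> \<le> E * M\<^sup>2" "\<bar>(a * b) * a\<^sup>2\<bar> \<le> E * M\<^sup>2"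
    unfolding abs_mult[of "a * b"] using ab M2 E by (auto intro!: mult_mono)
  moreover have "\<bar>a * p'\<bar> \<le> S * (J * (5/3 * M\<^sup>2 * S))" "\<bar>b * p\<bar> \<le> S * (J * (5/3 * M\<^sup>2 * S))"
     "\<bar>a * q\<bar> \<le> S * (J * (M\<^sup>2 * S))" "\<bar>b * q'\<bar> \<le> S * (J * (M\<^sup>2 * S))"
    by (intro prod aS bS p[folded E_def S_def] q[folded E_def S_def])+
  moreover have "S * (J * (5/3 * M\<^sup>2 * S)) = 5/3 * (J * M\<^sup>2 * E)" "S * (J * (M\<^sup>2 * S)) = J * M\<^sup>2 * E"
    by (simp_all flip: S)
  moreover have "(2 * \<beta> + 14/3 + 8 * J) * M\<^sup>2 * E = M\<^sup>2 * (2 * \<beta> * E) + 14/3 * (E * M\<^sup>2) + 8 * (J * M\<^sup>2 * E)"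
    by (simp add: algebra_simps)
  ultimately show ?thesis
    unfolding eq E_def[symmetric] by linarith
qed

section \<open>Maximum principle and decay estimates\<close>

context smooth_solution
begin

lemma M_nonneg: "0 \<le> M"
  using u_le[of 0 0] T by auto

lemma continuous_u: "t \<in> {0..T} \<Longrightarrow> continuous_on UNIV (u t)"
  by (rule DERIV_continuous_on, rule DERIV_u)

lemma continuous_w: "t \<in> {0..T} \<Longrightarrow> continuous_on UNIV (w t)"
  by (rule DERIV_continuous_on, rule DERIV_w)

lemma continuous_sources:
  assumes "t \<in> {0..T}"
  shows "continuous_on UNIV (\<lambda>y. 2/3 * (u t y)^3 + u t y * (w t y)\<^sup>2)" "continuous_on UNIV (\<lambda>y. (w t y)^3)"
  using continuous_u[OF assms] continuous_w[OF assms] by (auto intro!: continuous_intros)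

lemma bounded_sources:
  assumes "t \<in> {0..T}"
  shows "\<bar>2/3 * (u t y)^3 + u t y * (w t y)\<^sup>2\<bar> \<le> 5/3 * M\<^sup>2 * M" "\<bar>(w t y)^3\<bar> \<le> M\<^sup>2 * M"
  using cubic_le[OF u_le[OF assms, of y] w_le[OF assms, of y] u_le[OF assms, of y] w_le[OF assms, of y]] by simp_all

text \<open>The coefficient from \<open>energy_rate_le\<close>, with the constant of
  \<open>convolution_G_abs_le_weight\<close> as \<open>J\<close>, increased by 1; this surplus
  produces the contradiction in the maximum principle.\<close>

definition growth_rate :: "real \<Rightarrow> real" where
  "growth_rate \<beta> = (2 * \<beta> + 14/3 + 8 * ((LINT z|lborel. exp (- (1 - \<beta>) * \<bar>z\<bar>)) / 2)) * M\<^sup>2 + 1"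

text \<open>A maximum principle: at an interior maximum of \<open>exp (- L * t) * (u\<^sup>2 + w\<^sup>2) / \<sigma>\<^sup>2\<close>
  the transport term is controlled by the logarithmic derivative of the weight, and the nonlocal
  terms by the maximum itself.\<close>

lemma weighted_bound:
  fixes \<sigma> \<sigma>' :: "real \<Rightarrow> real"
  assumes \<beta>: "\<beta> < 1"
    and pos: "\<And>x. 0 < \<sigma> x" and DERIV_\<sigma>: "\<And>x. DERIV \<sigma> x :> \<sigma>' x" and \<sigma>': "\<And>x. \<bar>\<sigma>' x\<bar> \<le> \<beta> * \<sigma> x"
    and shift: "\<And>x z. \<sigma> (x - z) \<le> exp (\<beta> * \<bar>z\<bar>) * \<sigma> x"
    and coercive: "\<And>K. \<exists>R. \<forall>x. R < \<bar>x\<bar> \<longrightarrow> K \<le> \<sigma> x"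
    and init: "\<And>x. (u 0 x)\<^sup>2 + (w 0 x)\<^sup>2 \<le> B * (\<sigma> x)\<^sup>2"
    and t1: "t1 \<in> {0..T}"
  shows "(u t1 x1)\<^sup>2 + (w t1 x1)\<^sup>2 \<le> exp (growth_rate \<beta> * t1) * B * (\<sigma> x1)\<^sup>2"
proof (rule ccontr)
  define L where "L = growth_rate \<beta>"
  define E where "E t x = (u t x)\<^sup>2 + (w t x)\<^sup>2" for t x
  define h where "h t x = exp (- L * t) * (E t x / (\<sigma> x)\<^sup>2)" for t x
  define J where "J = (LINT z|lborel. exp (- (1 - \<beta>) * \<bar>z\<bar>)) / 2"
  have E0: "0 \<le> E t x" for t x by (simp add: E_def)
  have \<sigma>2: "0 < (\<sigma> x)\<^sup>2" for x by (rule zero_less_power[OF pos])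
  have \<sigma>0: "\<sigma> x \<noteq> 0" for x using pos[of x] by simp
  have J0: "0 \<le> J" unfolding J_def by (simp add: integral_nonneg_AE)
  have \<beta>0: "0 \<le> \<beta>" using \<sigma>'[of 0] pos[of 0] abs_ge_zero[of "\<sigma>' 0"] by (meson order_trans zero_le_mult_iff not_le)
  have B0: "0 \<le> B" 
    using init[of 0] \<sigma>2[of 0] sum_power2_ge_zero[of "u 0 0" "w 0 0"] by (meson order_trans zero_le_mult_iff not_le)
  have L0: "0 \<le> L" using \<beta>0 J0 by (simp add: L_def growth_rate_def J_def[symmetric])
  assume "\<not> ?thesis"
  then have "exp (L * t1) * B * (\<sigma> x1)\<^sup>2 < E t1 x1" by (simp add: L_def E_def)
  then have "exp (L * t1) * B < E t1 x1 / (\<sigma> x1)\<^sup>2"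
    using \<sigma>2[of x1] by (simp add: less_divide_eq)
  then have "exp (- L * t1) * (exp (L * t1) * B) < h t1 x1"
    unfolding h_def by (rule mult_strict_left_mono) simp
  then have h1: "B < h t1 x1"
    by (simp add: mult.assoc[symmetric] flip: exp_add)
  \<comment> \<open>The value at the point violating the claim serves as threshold: it is positive,
    and every point with larger \<open>h\<close> lies in a bounded region.\<close>
  define \<eta> where "\<eta> = h t1 x1"
  have \<eta>: "0 < \<eta>" using h1 B0 by (simp add: \<eta>_def)
  \<comment> \<open>The level is such that the crude bound 2 M^2 for \<open>E\<close> is already
    below \<eta> times the squared weight outside \<open>R\<close>.\<close>
  obtain R where R: "\<And>x. R < \<bar>x\<bar> \<Longrightarrow> sqrt ((2 * M\<^sup>2 + 1) / \<eta>) \<le> \<sigma> x"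
    using coercive by blast
  have far: "h t x < \<eta>" if "R < \<bar>x\<bar>" "t \<in> {0..T}" for t x
  proof -
    have "(2 * M\<^sup>2 + 1) / \<eta> \<le> (\<sigma> x)\<^sup>2"
      using R[OF that(1)] pos[of x] by (simp add: real_sqrt_le_iff' sqrt_le_D)
    then have "2 * M\<^sup>2 + 1 \<le> \<eta> * (\<sigma> x)\<^sup>2" using \<eta> by (simp add: divide_le_eq mult.commute)
    moreover have "(u t x)\<^sup>2 \<le> M\<^sup>2" "(w t x)\<^sup>2 \<le> M\<^sup>2"
      using u_le[OF that(2), of x] w_le[OF that(2), of x] by (simp_all add: abs_le_square_iff[symmetric])
    ultimately have "E t x < \<eta> * (\<sigma> x)\<^sup>2" by (simp add: E_def)
    then have "E t x / (\<sigma> x)\<^sup>2 < \<eta>" using \<sigma>2[of x] by (simp add: divide_less_eq)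
    moreover have "h t x \<le> 1 * (E t x / (\<sigma> x)\<^sup>2)"
      unfolding h_def using L0 that E0 by (intro mult_right_mono) auto
    ultimately show ?thesis by simp
  qed
  \<comment> \<open>The rectangle is enlarged to contain \<open>x1\<close>, so that its maximum is
    at least \<eta> and therefore a maximum over the whole strip.\<close>
  define R' where "R' = max \<bar>R\<bar> \<bar>x1\<bar>"
  let ?K = "{0..T} \<times> {- R'..R'}"
  have "continuous_on ?K (\<lambda>(t, x). h t x)"
  proof -
    have "continuous_on ?K (\<lambda>z. u (fst z) (snd z))" "continuous_on ?K (\<lambda>z. w (fst z) (snd z))"
      using cont_u cont_w by (auto simp: case_prod_unfold elim!: continuous_on_subset)
    moreover have "continuous_on UNIV \<sigma>"
      by (rule DERIV_continuous_on, rule DERIV_\<sigma>)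
    then have "continuous_on ?K (\<lambda>z. \<sigma> (snd z))"
      by (rule continuous_on_compose2) (auto intro!: continuous_intros)
    ultimately show ?thesis
      unfolding case_prod_unfold h_def E_def using \<sigma>0 by (auto intro!: continuous_intros)
  qed
  moreover have "compact ?K" by (intro compact_Times) auto
  moreover have in_K: "(t1, x1) \<in> ?K" using t1 by (auto simp: R'_def)
  ultimately obtain t0 x0 where K0: "(t0, x0) \<in> ?K" and max: "\<And>t x. (t, x) \<in> ?K \<Longrightarrow> h t x \<le> h t0 x0"
    using continuous_attains_sup[of ?K "\<lambda>(t, x). h t x"] by fastforce
  have h0: "\<eta> \<le> h t0 x0" using max[OF in_K] by (simp add: \<eta>_def)
  have t0: "t0 \<in> {0..T}" using K0 by simp
  have max: "h t x \<le> h t0 x0" if "t \<in> {0..T}" for t x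
  proof (cases "R < \<bar>x\<bar>")
    case True
    then show ?thesis using far[OF True that] h0 by simp
  next
    case False
    then show ?thesis using that by (intro max) (auto simp: R'_def)
  qed
  \<comment> \<open>The initial bound keeps \<open>h\<close> at most \<open>B\<close> at time 0,
    below the maximum; hence the maximum occurs at positive time.\<close>
  have "h 0 x0 \<le> B"
    using init[of x0] \<sigma>2[of x0] by (simp add: h_def E_def divide_le_eq)
  then have "t0 \<noteq> 0" using h0 h1 by (auto simp: \<eta>_def)
  then have t0': "0 < t0" "t0 \<le> T" using t0 by auto
  have Epos: "0 < E t0 x0"
    using h0 \<eta> E0[of t0 x0] by (cases "E t0 x0 = 0") (auto simp: h_def)
  let ?p = "convolution G (\<lambda>y. 2/3 * (u t0 y)^3 + u t0 y * (w t0 y)\<^sup>2)"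
  let ?q = "convolution G (\<lambda>y. (w t0 y)^3)"
  define e where "e = 2 * u t0 x0 * (- (((u t0 x0)\<^sup>2 - (w t0 x0)\<^sup>2) * w t0 x0) - 2/3 * (w t0 x0)^3 - deriv ?p x0 - 1/3 * ?q x0)
      + 2 * w t0 x0 * (- (((u t0 x0)\<^sup>2 - (w t0 x0)\<^sup>2) * v t0 x0) - u t0 x0 * (w t0 x0)\<^sup>2 + 2/3 * (u t0 x0)^3 - ?p x0 - 1/3 * deriv ?q x0)"
  define d where "d = 2 * u t0 x0 * w t0 x0 + 2 * w t0 x0 * v t0 x0"
  have "((\<lambda>t. E t x0) has_real_derivative e) (at t0 within {0..T})"
    unfolding E_def by (rule derivative_eq_intros u_t[OF t0] w_t[OF t0] refl)+ (simp add: e_def)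
  then have "((\<lambda>t. exp (- L * t) * (E t x0 * k)) has_real_derivative
      exp (- L * t0) * (e - L * E t0 x0) * k) (at t0 within {0..T})" for k
    by (auto intro!: derivative_eq_intros simp: algebra_simps)
  from this[of "inverse ((\<sigma> x0)\<^sup>2)"]
  have "((\<lambda>t. exp (- L * t) * (E t x0 / (\<sigma> x0)\<^sup>2)) has_real_derivative
      exp (- L * t0) * (e - L * E t0 x0) / (\<sigma> x0)\<^sup>2) (at t0 within {0..T})"
    by (simp only: divide_inverse)
  then have "0 \<le> exp (- L * t0) * (e - L * E t0 x0) / (\<sigma> x0)\<^sup>2"
    using max[of _ x0] by (intro has_real_derivative_nonneg_at_max[OF _ t0']) (auto simp: h_def)
  then have le1: "L * E t0 x0 \<le> e"
    using \<sigma>2[of x0] by (simp add: zero_le_divide_iff zero_le_mult_iff)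
  \<comment> \<open>Vanishing of the space derivative of \<open>h\<close> at \<open>x0\<close>
    expresses \<open>d\<close> through the logarithmic derivative of the weight, which is at most
    \<beta> in absolute value.\<close>
  have "DERIV (E t0) x0 :> d"
    unfolding E_def by (rule derivative_eq_intros DERIV_u[OF t0] DERIV_w[OF t0] refl)+ (simp add: d_def)
  then have "DERIV (h t0) x0 :> exp (- L * t0) * ((d * (\<sigma> x0)\<^sup>2 - E t0 x0 * (2 * \<sigma> x0 * \<sigma>' x0)) / ((\<sigma> x0)\<^sup>2 * (\<sigma> x0)\<^sup>2))"
    unfolding h_def using \<sigma>0[of x0] DERIV_\<sigma>[of x0]
    by (auto intro!: derivative_eq_intros simp: algebra_simps)
  then have "exp (- L * t0) * ((d * (\<sigma> x0)\<^sup>2 - E t0 x0 * (2 * \<sigma> x0 * \<sigma>' x0)) / ((\<sigma> x0)\<^sup>2 * (\<sigma> x0)\<^sup>2)) = 0"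
    by (rule DERIV_local_max[of _ _ _ 1]) (use max[OF t0] in auto)
  then have "d * (\<sigma> x0)\<^sup>2 - E t0 x0 * (2 * \<sigma> x0 * \<sigma>' x0) = 0"
    using \<sigma>0[of x0] by simp
  then have d_eq: "d * \<sigma> x0 = 2 * E t0 x0 * \<sigma>' x0"
    using \<sigma>0[of x0] by (simp add: power2_eq_square)
  have "\<bar>d\<bar> * \<sigma> x0 = \<bar>d * \<sigma> x0\<bar>"
    using pos[of x0] by (simp add: abs_mult)
  also have "\<dots> = 2 * E t0 x0 * \<bar>\<sigma>' x0\<bar>"
    unfolding d_eq using E0 by (simp add: abs_mult)
  also have "\<dots> \<le> 2 * E t0 x0 * (\<beta> * \<sigma> x0)"
    using E0 by (intro mult_left_mono \<sigma>') simp
  finally have "\<bar>d\<bar> * \<sigma> x0 \<le> (2 * \<beta> * E t0 x0) * \<sigma> x0" by (simp add: mult_ac)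
  then have d_le: "\<bar>d\<bar> \<le> 2 * \<beta> * E t0 x0"
    by (rule mult_right_le_imp_le) (rule pos)
  \<comment> \<open>Maximality says that \<open>E t0\<close> lies below the square of
    \<open>c\<close> times the weight everywhere, with equality at \<open>x0\<close>. This turns the
    nonlocal terms into multiples of \<open>sqrt (E t0 x0)\<close>.\<close>
  define c where "c = sqrt (E t0 x0) / \<sigma> x0"
  have c0: "0 \<le> c" unfolding c_def using E0 pos[of x0] by simp
  have c\<sigma>: "c * \<sigma> x0 = sqrt (E t0 x0)" unfolding c_def using \<sigma>0 by simp
  have E_le: "E t0 y \<le> (c * \<sigma> y)\<^sup>2" for y
  proof -
    have "E t0 y / (\<sigma> y)\<^sup>2 \<le> E t0 x0 / (\<sigma> x0)\<^sup>2"
      using max[OF t0, of y] unfolding h_def by (subst (asm) mult_le_cancel_left_pos) (simp_all only: exp_gt_zero)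
    also have "\<dots> = c\<^sup>2" unfolding c_def by (simp add: power_divide E0)
    finally show ?thesis using \<sigma>2[of y] by (simp add: divide_le_eq power_mult_distrib)
  qed
  have uw_le: "\<bar>u t0 y\<bar> \<le> c * \<sigma> y" "\<bar>w t0 y\<bar> \<le> c * \<sigma> y" for y
  proof -
    have "0 \<le> c * \<sigma> y" using c0 pos[of y] by simp
    moreover have "(u t0 y)\<^sup>2 \<le> (c * \<sigma> y)\<^sup>2" "(w t0 y)\<^sup>2 \<le> (c * \<sigma> y)\<^sup>2"
      using E_le[of y] zero_le_power2[of "u t0 y"] zero_le_power2[of "w t0 y"] unfolding E_def by linarith+
    ultimately show "\<bar>u t0 y\<bar> \<le> c * \<sigma> y" "\<bar>w t0 y\<bar> \<le> c * \<sigma> y"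
      by (simp_all add: abs_le_square_iff[symmetric])
  qed
  have src: "\<bar>2/3 * (u t0 y)^3 + u t0 y * (w t0 y)\<^sup>2\<bar> \<le> (5/3 * M\<^sup>2 * c) * \<sigma> y" "\<bar>(w t0 y)^3\<bar> \<le> (M\<^sup>2 * c) * \<sigma> y" for y
    using cubic_le[OF u_le[OF t0] w_le[OF t0] uw_le, of y] by (simp_all add: mult.assoc)
  note weight = convolution_G_abs_le_weight[OF continuous_sources(1)[OF t0] bounded_sources(1)[OF t0] \<beta> shift src(1), of x0]
    convolution_G_abs_le_weight[OF continuous_sources(2)[OF t0] bounded_sources(2)[OF t0] \<beta> shift src(2), of x0]
  have P: "convolution G (\<lambda>y. \<bar>2/3 * (u t0 y)^3 + u t0 y * (w t0 y)\<^sup>2\<bar>) x0 \<le> J * (5/3 * M\<^sup>2 * sqrt (E t0 x0))"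
    using weight(1) c0 c\<sigma> by (simp add: J_def mult.assoc)
  have Q: "convolution G (\<lambda>y. \<bar>(w t0 y)^3\<bar>) x0 \<le> J * (M\<^sup>2 * sqrt (E t0 x0))"
    using weight(2) c0 c\<sigma> by (simp add: J_def mult.assoc)
  have "e \<le> (2 * \<beta> + 14/3 + 8 * J) * M\<^sup>2 * E t0 x0"
    unfolding E_def
  proof (rule energy_rate_le[OF u_le[OF t0] w_le[OF t0] d_def _ _ _ _ _ e_def])
    show "\<bar>d\<bar> \<le> 2 * \<beta> * ((u t0 x0)\<^sup>2 + (w t0 x0)\<^sup>2)"
      using d_le by (simp add: E_def)
  qed (use convolution_G_le[OF continuous_sources(1)[OF t0] bounded_sources(1)[OF t0], of x0]
      convolution_G_le[OF continuous_sources(2)[OF t0] bounded_sources(2)[OF t0], of x0] P Q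
      in \<open>simp_all add: E_def\<close>)
  \<comment> \<open>Nonnegativity of the time derivative gives L E \<le> e, while the energy
    estimate gives e \<le> (L - 1) E.\<close>
  then have "(L - 1) * E t0 x0 + E t0 x0 \<le> (L - 1) * E t0 x0"
    using le1 by (simp add: L_def growth_rate_def J_def algebra_simps)
  then show False using Epos by simp
qed

text \<open>The weights \<open>exp (- \<beta> * x) + \<epsilon> * exp (\<beta> * x)\<close> are coercive, which makes the maximum
  principle applicable; \<open>\<epsilon>\<close> then tends to zero.\<close>

lemma exp_decay:
  assumes \<beta>: "0 < \<beta>" "\<beta> < 1" and init: "\<And>x. (u 0 x)\<^sup>2 + (w 0 x)\<^sup>2 \<le> B * (exp (- \<beta> * x))\<^sup>2"
  shows "\<exists>C\<ge>0. \<forall>t\<in>{0..T}. \<forall>x. \<bar>u t x\<bar> \<le> C * exp (- \<beta> * x) \<and> \<bar>w t x\<bar> \<le> C * exp (- \<beta> * x)"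
proof -
  define L where "L = growth_rate \<beta>"
  have B0: "0 \<le> B"
    using order_trans[OF sum_power2_ge_zero init[of 0]] by simp
  have bound: "(u t x)\<^sup>2 + (w t x)\<^sup>2 \<le> exp (L * t) * B * (exp (- \<beta> * x) + \<epsilon> * exp (\<beta> * x))\<^sup>2"
    if t: "t \<in> {0..T}" and \<epsilon>: "0 < \<epsilon>" for t x \<epsilon>
    unfolding L_def
  proof (rule weighted_bound[OF \<beta>(2), where \<sigma>' = "\<lambda>x. - \<beta> * exp (- \<beta> * x) + \<epsilon> * (\<beta> * exp (\<beta> * x))", OF _ _ _ _ _ _ t])
    fix x z K :: real
    show "0 < exp (- \<beta> * x) + \<epsilon> * exp (\<beta> * x)"
      using \<epsilon> by (intro add_pos_pos mult_pos_pos) auto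
    show "DERIV (\<lambda>x. exp (- \<beta> * x) + \<epsilon> * exp (\<beta> * x)) x :> - \<beta> * exp (- \<beta> * x) + \<epsilon> * (\<beta> * exp (\<beta> * x))"
      by (auto intro!: derivative_eq_intros)
    have "\<bar>- \<beta> * exp (- \<beta> * x)\<bar> = \<beta> * exp (- \<beta> * x)" "\<bar>\<epsilon> * (\<beta> * exp (\<beta> * x))\<bar> = \<beta> * (\<epsilon> * exp (\<beta> * x))"
      using \<beta> \<epsilon> by (simp_all add: abs_mult)
    then show "\<bar>- \<beta> * exp (- \<beta> * x) + \<epsilon> * (\<beta> * exp (\<beta> * x))\<bar> \<le> \<beta> * (exp (- \<beta> * x) + \<epsilon> * exp (\<beta> * x))"
      unfolding distrib_left by linarith
    \<comment> \<open>Each exponential separately changes by at most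
      \<open>exp (\<beta> * \<bar>z\<bar>)\<close> under a shift by \<open>z\<close>, hence so does
      their sum.\<close>
    have "\<beta> * z \<le> \<beta> * \<bar>z\<bar>" "- (\<beta> * z) \<le> \<beta> * \<bar>z\<bar>"
      using \<beta> by (auto simp: abs_if intro: order_trans[of _ 0] mult_nonneg_nonpos mult_nonneg_nonneg)
    then have "exp (- \<beta> * (x - z)) \<le> exp (\<beta> * \<bar>z\<bar>) * exp (- \<beta> * x)" "exp (\<beta> * (x - z)) \<le> exp (\<beta> * \<bar>z\<bar>) * exp (\<beta> * x)"
      by (simp_all add: algebra_simps flip: exp_add)
    moreover from this(2) have "\<epsilon> * exp (\<beta> * (x - z)) \<le> \<epsilon> * (exp (\<beta> * \<bar>z\<bar>) * exp (\<beta> * x))"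
      using \<epsilon> by (intro mult_left_mono) auto
    ultimately show "exp (- \<beta> * (x - z)) + \<epsilon> * exp (\<beta> * (x - z)) \<le> exp (\<beta> * \<bar>z\<bar>) * (exp (- \<beta> * x) + \<epsilon> * exp (\<beta> * x))"
      by (simp add: distrib_left mult_ac)
    have "exp (- \<beta> * x) \<le> exp (- \<beta> * x) + \<epsilon> * exp (\<beta> * x)"
      using \<epsilon> by simp
    then have "(exp (- \<beta> * x))\<^sup>2 \<le> (exp (- \<beta> * x) + \<epsilon> * exp (\<beta> * x))\<^sup>2"
      by (rule power_mono) simp
    then have "B * (exp (- \<beta> * x))\<^sup>2 \<le> B * (exp (- \<beta> * x) + \<epsilon> * exp (\<beta> * x))\<^sup>2"
      using B0 by (rule mult_left_mono)
    with init[of x] show "(u 0 x)\<^sup>2 + (w 0 x)\<^sup>2 \<le> B * (exp (- \<beta> * x) + \<epsilon> * exp (\<beta> * x))\<^sup>2"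
      by linarith
    \<comment> \<open>On either side one of the exponentials equals
      \<open>exp (\<beta> * \<bar>x\<bar>)\<close> and has coefficient at least
      \<open>min 1 \<epsilon>\<close>; the value of \<open>R\<close> then follows from exp y \<ge>
      y.\<close>
    define R where "R = (\<bar>K\<bar> / min 1 \<epsilon>) / \<beta>"
    show "\<exists>R. \<forall>x. R < \<bar>x\<bar> \<longrightarrow> K \<le> exp (- \<beta> * x) + \<epsilon> * exp (\<beta> * x)"
    proof (intro exI allI impI)
      fix x assume x: "R < \<bar>x\<bar>"
      have min: "0 < min 1 \<epsilon>" using \<epsilon> by simp
      have "\<bar>K\<bar> / min 1 \<epsilon> < \<beta> * \<bar>x\<bar>"
        using x unfolding R_def pos_divide_less_eq[OF \<beta>(1)] by (simp only: mult.commute)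
      also have "\<beta> * \<bar>x\<bar> \<le> exp (\<beta> * \<bar>x\<bar>)"
        using exp_ge_add_one_self[of "\<beta> * \<bar>x\<bar>"] by linarith
      finally have "\<bar>K\<bar> < min 1 \<epsilon> * exp (\<beta> * \<bar>x\<bar>)"
        unfolding pos_divide_less_eq[OF min] by (simp only: mult.commute)
      also have "\<dots> \<le> exp (- \<beta> * x) + \<epsilon> * exp (\<beta> * x)"
      proof (cases "0 \<le> x")
        case True
        have "min 1 \<epsilon> * exp (\<beta> * x) \<le> \<epsilon> * exp (\<beta> * x)" by (intro mult_right_mono) auto
        then show ?thesis using True by (simp add: add_increasing)
      next
        case False
        have "min 1 \<epsilon> * exp (- \<beta> * x) \<le> 1 * exp (- \<beta> * x)" by (intro mult_right_mono) auto
        moreover have "0 \<le> \<epsilon> * exp (\<beta> * x)" using \<epsilon> by simp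
        moreover have "min 1 \<epsilon> * exp (\<beta> * \<bar>x\<bar>) = min 1 \<epsilon> * exp (- \<beta> * x)" using False by simp
        ultimately show ?thesis by linarith
      qed
      finally show "K \<le> exp (- \<beta> * x) + \<epsilon> * exp (\<beta> * x)" by simp
    qed
  qed
  \<comment> \<open>The growth rate does not involve \<epsilon>, so \<epsilon> may tend to zero at a
    fixed point; afterwards \<open>L * t\<close> is replaced by a bound uniform in time.\<close>
  have le: "(u t x)\<^sup>2 + (w t x)\<^sup>2 \<le> exp (\<bar>L\<bar> * T) * B * (exp (- \<beta> * x))\<^sup>2" if t: "t \<in> {0..T}" for t x
  proof -
    have "((\<lambda>\<epsilon>. exp (L * t) * B * (exp (- \<beta> * x) + \<epsilon> * exp (\<beta> * x))\<^sup>2) \<longlongrightarrow> exp (L * t) * B * (exp (- \<beta> * x) + 0 * exp (\<beta> * x))\<^sup>2) (at_right 0)"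
      by (intro tendsto_intros)
    then have "(u t x)\<^sup>2 + (w t x)\<^sup>2 \<le> exp (L * t) * B * (exp (- \<beta> * x) + 0 * exp (\<beta> * x))\<^sup>2"
      by (rule tendsto_lowerbound) (use bound[OF t] in \<open>auto simp: eventually_at_right_less eventually_at_filter\<close>)
    also have "\<dots> \<le> exp (\<bar>L\<bar> * T) * B * (exp (- \<beta> * x))\<^sup>2"
    proof -
      have "L * t \<le> \<bar>L\<bar> * T"
        using t by (intro mult_mono) auto
      then show ?thesis using B0 by (auto intro!: mult_right_mono)
    qed
    finally show ?thesis .
  qed
  define C where "C = sqrt (exp (\<bar>L\<bar> * T) * B)"
  have C: "C\<^sup>2 = exp (\<bar>L\<bar> * T) * B" "0 \<le> C" using B0 by (simp_all add: C_def)
  have "\<bar>u t x\<bar> \<le> C * exp (- \<beta> * x) \<and> \<bar>w t x\<bar> \<le> C * exp (- \<beta> * x)" if t: "t \<in> {0..T}" for t x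
  proof -
    have "(u t x)\<^sup>2 \<le> (C * exp (- \<beta> * x))\<^sup>2" "(w t x)\<^sup>2 \<le> (C * exp (- \<beta> * x))\<^sup>2"
      using le[OF t, of x] zero_le_power2[of "u t x"] zero_le_power2[of "w t x"]
      unfolding power_mult_distrib C(1) by linarith+
    moreover have "0 \<le> C * exp (- \<beta> * x)" using C(2) by simp
    ultimately show ?thesis
      by (simp add: abs_le_square_iff[symmetric])
  qed
  then show ?thesis using C(2) by blast
qed

text \<open>Cubing triples the decay rate past 1, so the sources multiplied by \<open>exp y\<close>
  become integrable: on the right by decay, on the left by boundedness. Local and nonlocal terms in
  the time derivative of \<open>u\<close> are then O(exp (- x)) uniformly in time, and the mean
  value inequality in time concludes.\<close>

lemma exp_decay_improved:
  assumes \<beta>: "1/3 < \<beta>" and C: "0 \<le> C"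
    and decay: "\<And>t x. t \<in> {0..T} \<Longrightarrow> \<bar>u t x\<bar> \<le> C * exp (- \<beta> * x)" "\<And>t x. t \<in> {0..T} \<Longrightarrow> \<bar>w t x\<bar> \<le> C * exp (- \<beta> * x)"
  shows "\<exists>D. \<forall>t\<in>{0..T}. \<forall>x\<ge>0. \<bar>u t x - u 0 x\<bar> \<le> D * exp (- x)"
proof -
  \<comment> \<open>Common rate for \<open>exp y\<close> times a cube: 3 \<beta> - 1 on the right,
    and 1 on the left, where the cube is only bounded.\<close>
  define a where "a = min 1 (3 * \<beta> - 1)"
  have a: "0 < a" "a \<le> 1" "a \<le> 3 * \<beta> - 1" using \<beta> by (auto simp: a_def)
  define N where "N = C + M"
  have N: "0 \<le> N" "C \<le> N" "M \<le> N" using C M_nonneg by (auto simp: N_def)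
  define I where "I = (LINT z|lborel. exp (- a * \<bar>z\<bar>))"
  have cube: "exp y * (N * min 1 (exp (- \<beta> * y)))^3 \<le> N^3 * exp (- a * \<bar>y\<bar>)" for y
  proof -
    have "exp y * (min 1 (exp (- \<beta> * y)))^3 \<le> exp (- a * \<bar>y\<bar>)"
    proof (cases "0 \<le> y")
      case True
      have "(min 1 (exp (- \<beta> * y)))^3 \<le> (exp (- \<beta> * y))^3" by (intro power_mono) auto
      then have "exp y * (min 1 (exp (- \<beta> * y)))^3 \<le> exp y * (exp (- \<beta> * y))^3" by simp
      also have "\<dots> = exp (- (3 * \<beta> - 1) * y)"
        by (simp add: algebra_simps flip: exp_add exp_of_nat_mult)
      also have "\<dots> \<le> exp (- a * \<bar>y\<bar>)"
        using mult_right_mono[OF a(3) True] True by (simp add: algebra_simps)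
      finally show ?thesis .
    next
      case False
      have "(min 1 (exp (- \<beta> * y)))^3 \<le> 1" by (intro power_le_one) auto
      then have "exp y * (min 1 (exp (- \<beta> * y)))^3 \<le> exp y * 1" by (intro mult_left_mono) auto
      also have "\<dots> \<le> exp (- a * \<bar>y\<bar>)"
        using False a by (simp add: mult_le_cancel_right1)
      finally show ?thesis .
    qed
    then have "N^3 * (exp y * (min 1 (exp (- \<beta> * y)))^3) \<le> N^3 * exp (- a * \<bar>y\<bar>)"
      using N by (intro mult_left_mono) auto
    then show ?thesis by (simp add: power_mult_distrib mult_ac)
  qed
  \<comment> \<open>\<open>m\<close> combines the global bound \<open>M\<close> with the decay
    bound, since \<open>N\<close> dominates both constants.\<close>
  define m where "m y = N * min 1 (exp (- \<beta> * y))" for y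
  have uw: "\<bar>u t y\<bar> \<le> m y" "\<bar>w t y\<bar> \<le> m y" if t: "t \<in> {0..T}" for t y
  proof -
    have "C * exp (- \<beta> * y) \<le> N * exp (- \<beta> * y)" using N by (intro mult_right_mono) auto
    moreover have "m y = min N (N * exp (- \<beta> * y))" using N by (simp add: m_def min_mult_distrib_left)
    ultimately show "\<bar>u t y\<bar> \<le> m y" "\<bar>w t y\<bar> \<le> m y"
      using decay[OF t, of y] u_le[OF t, of y] w_le[OF t, of y] N by linarith+
  qed
  have src: "\<bar>2/3 * (u t y)^3 + u t y * (w t y)\<^sup>2\<bar> \<le> 5/3 * (m y)^3" "\<bar>(w t y)^3\<bar> \<le> (m y)^3" if t: "t \<in> {0..T}" for t y
    using cubic_le[OF uw[OF t] uw[OF t], of y] by (simp_all add: power2_eq_square power3_eq_cube mult_ac)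
  have srcw: "exp y * \<bar>2/3 * (u t y)^3 + u t y * (w t y)\<^sup>2\<bar> \<le> (5/3 * N^3) * exp (- a * \<bar>y\<bar>)"
       "exp y * \<bar>(w t y)^3\<bar> \<le> N^3 * exp (- a * \<bar>y\<bar>)" if t: "t \<in> {0..T}" for t y
  proof -
    have "exp y * \<bar>2/3 * (u t y)^3 + u t y * (w t y)\<^sup>2\<bar> \<le> exp y * (5/3 * (m y)^3)" "exp y * \<bar>(w t y)^3\<bar> \<le> exp y * (m y)^3"
      by (intro mult_left_mono src t; simp)+
    then show "exp y * \<bar>2/3 * (u t y)^3 + u t y * (w t y)\<^sup>2\<bar> \<le> (5/3 * N^3) * exp (- a * \<bar>y\<bar>)"
       "exp y * \<bar>(w t y)^3\<bar> \<le> N^3 * exp (- a * \<bar>y\<bar>)"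
      using cube[of y] unfolding m_def by linarith+
  qed
  \<comment> \<open>The term 3 N^3 leaves ample room for the local cubic terms; the other two bound
    the two convolutions.\<close>
  define D where "D = 3 * N^3 + (5/3 * N^3) * I / 2 + N^3 * I / 2"
  have I0: "0 \<le> I" unfolding I_def by (simp add: integral_nonneg_AE)
  have rate: "\<bar>- (((u t x)\<^sup>2 - (w t x)\<^sup>2) * w t x) - 2/3 * (w t x)^3
        - deriv (convolution G (\<lambda>y. 2/3 * (u t y)^3 + u t y * (w t y)\<^sup>2)) x
        - 1/3 * convolution G (\<lambda>y. (w t y)^3) x\<bar> \<le> D * exp (- x)" if t: "t \<in> {0..T}" and x: "0 \<le> x" for t x
  proof -
    have "\<bar>deriv (convolution G (\<lambda>y. 2/3 * (u t y)^3 + u t y * (w t y)\<^sup>2)) x\<bar> \<le> (5/3 * N^3) * I / 2 * exp (- x)"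
      unfolding I_def
      by (rule order_trans[OF convolution_G_le(2)[OF continuous_sources(1)[OF t] bounded_sources(1)[OF t]]
          convolution_G_abs_le_exp[OF continuous_sources(1)[OF t] bounded_sources(1)[OF t] a(1) srcw(1)[OF t]]])
    moreover have "\<bar>convolution G (\<lambda>y. (w t y)^3) x\<bar> \<le> N^3 * I / 2 * exp (- x)"
      unfolding I_def
      by (rule order_trans[OF convolution_G_le(1)[OF continuous_sources(2)[OF t] bounded_sources(2)[OF t]]
          convolution_G_abs_le_exp[OF continuous_sources(2)[OF t] bounded_sources(2)[OF t] a(1) srcw(2)[OF t]]])
    moreover have "(m x)^3 \<le> N^3 * exp (- x)"
    proof -
      have "(m x)^3 \<le> (N * exp (- \<beta> * x))^3"
        using N by (intro power_mono) (auto simp: m_def intro!: mult_left_mono)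
      also have "\<dots> = N^3 * exp (- (3 * \<beta>) * x)"
        by (simp add: power_mult_distrib flip: exp_of_nat_mult)
      also have "\<dots> \<le> N^3 * exp (- x)"
        using N \<beta> x by (intro mult_left_mono) (auto simp: mult_le_cancel_right1)
      finally show ?thesis .
    qed
    moreover have "\<bar>(w t x)^3\<bar> \<le> (m x)^3" by (rule src[OF t])
    moreover have "\<bar>(u t x)\<^sup>2 * w t x\<bar> \<le> (m x)^3"
    proof -
      have "\<bar>u t x\<bar>\<^sup>2 * \<bar>w t x\<bar> \<le> (m x)\<^sup>2 * m x"
        using uw[OF t, of x] by (intro mult_mono power_mono) auto
      then show ?thesis by (simp add: abs_mult power2_eq_square power3_eq_cube)
    qed
    moreover have "((u t x)\<^sup>2 - (w t x)\<^sup>2) * w t x = (u t x)\<^sup>2 * w t x - (w t x)^3"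
      by (simp add: algebra_simps power2_eq_square power3_eq_cube)
    moreover have "D * exp (- x) = 3 * (N^3 * exp (- x)) + (5/3 * N^3) * I / 2 * exp (- x) + N^3 * I / 2 * exp (- x)"
      by (simp add: D_def distrib_right)
    ultimately show ?thesis by linarith
  qed
  have "\<bar>u t x - u 0 x\<bar> \<le> (D * T) * exp (- x)" if t: "t \<in> {0..T}" and x: "0 \<le> x" for t x
  proof -
    have "norm (u t x - u 0 x) \<le> D * exp (- x) * norm (t - 0)"
      by (rule field_differentiable_bound[where S = "{0..T}" and f = "\<lambda>t. u t x", OF _ u_t])
        (use t T rate x in auto)
    also have "\<dots> \<le> D * exp (- x) * T"
      using t N I0 by (intro mult_left_mono) (auto simp: D_def)
    finally show ?thesis by (simp add: mult_ac)
  qed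
  then show ?thesis by blast
qed

text \<open>The asymptotic assumptions are first turned into bounds for all \<open>x\<close>, as
  required by \<open>exp_decay\<close>; the improved estimate for \<open>u t - u 0\<close> is then
  added to the decay of \<open>u 0\<close>.\<close>

lemma persistence:
  assumes \<beta>: "1/3 < \<beta>" "\<beta> < 1"
    and u0: "u 0 \<in> O[at_top](\<lambda>x. exp (- x))" and w0: "w 0 \<in> O[at_top](\<lambda>x. exp (- \<beta> * x))"
  shows "\<exists>C. \<forall>\<^sub>F x in at_top. \<forall>t\<in>{0..T}. \<bar>u t x\<bar> \<le> C * exp (- x)"
proof -
  obtain c1 where c1: "0 < c1" "\<forall>\<^sub>F x in at_top. norm (u 0 x) \<le> c1 * norm (exp (- x))"
    using u0 by (auto elim!: landau_o.bigE)
  obtain c2 where c2: "0 < c2" "\<forall>\<^sub>F x in at_top. norm (w 0 x) \<le> c2 * norm (exp (- \<beta> * x))"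
    using w0 by (rule landau_o.bigE)
  have "\<forall>\<^sub>F x in at_top. \<bar>u 0 x\<bar> \<le> c1 * exp (- x) \<and> \<bar>w 0 x\<bar> \<le> c2 * exp (- \<beta> * x)"
    using c1(2) c2(2) by eventually_elim simp
  then obtain X where X: "\<And>x. X \<le> x \<Longrightarrow> \<bar>u 0 x\<bar> \<le> c1 * exp (- x) \<and> \<bar>w 0 x\<bar> \<le> c2 * exp (- \<beta> * x)"
    unfolding eventually_at_top_linorder by blast
  \<comment> \<open>For x < |X| the weight \<open>exp (- \<beta> * x)\<close> is at least
    \<open>exp (- \<beta> * \<bar>X\<bar>)\<close>, so the last summand lets the sup bound
    \<open>M\<close> cover these points.\<close>
  define A where "A = c1 + c2 + M * exp (\<beta> * \<bar>X\<bar>)"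
  have A: "0 \<le> A" "c1 \<le> A" "c2 \<le> A" "M * exp (\<beta> * \<bar>X\<bar>) \<le> A"
    using c1(1) c2(1) M_nonneg by (auto simp: A_def add_nonneg_nonneg)
  have init: "\<bar>u 0 x\<bar> \<le> A * exp (- \<beta> * x) \<and> \<bar>w 0 x\<bar> \<le> A * exp (- \<beta> * x)" for x
  proof (cases "\<bar>X\<bar> \<le> x")
    case True
    have "exp (- x) \<le> exp (- \<beta> * x)" using mult_right_mono[of \<beta> 1 x] \<beta> True by simp
    then have "c1 * exp (- x) \<le> A * exp (- \<beta> * x)" using A c1(1) by (intro mult_mono) auto
    moreover have "c2 * exp (- \<beta> * x) \<le> A * exp (- \<beta> * x)" using A by (intro mult_right_mono) auto
    moreover have "X \<le> x" using True by simp
    ultimately show ?thesis using X[of x] by (meson order_trans)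
  next
    case False
    have "0 \<in> {0..T}" using T by simp
    note b = u_le[OF this, of x] w_le[OF this, of x]
    have "1 \<le> exp (\<beta> * \<bar>X\<bar>) * exp (- \<beta> * x)"
      using False \<beta> by (simp flip: exp_add)
    then have "M * 1 \<le> M * (exp (\<beta> * \<bar>X\<bar>) * exp (- \<beta> * x))"
      using M_nonneg by (rule mult_left_mono)
    also have "\<dots> \<le> A * exp (- \<beta> * x)"
      unfolding mult.assoc[symmetric] using A by (intro mult_right_mono) auto
    finally show ?thesis using b by simp
  qed
  have "(u 0 x)\<^sup>2 + (w 0 x)\<^sup>2 \<le> 2 * A\<^sup>2 * (exp (- \<beta> * x))\<^sup>2" for x
  proof -
    have "\<bar>u 0 x\<bar>\<^sup>2 \<le> (A * exp (- \<beta> * x))\<^sup>2" "\<bar>w 0 x\<bar>\<^sup>2 \<le> (A * exp (- \<beta> * x))\<^sup>2"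
      by (intro power_mono init[THEN conjunct1] init[THEN conjunct2] abs_ge_zero)+
    then show ?thesis unfolding power2_abs power_mult_distrib by linarith
  qed
  then obtain C where "0 \<le> C" "\<And>t x. t \<in> {0..T} \<Longrightarrow> \<bar>u t x\<bar> \<le> C * exp (- \<beta> * x) \<and> \<bar>w t x\<bar> \<le> C * exp (- \<beta> * x)"
    using exp_decay[of \<beta> "2 * A\<^sup>2"] \<beta> by fastforce
  then obtain D where D: "\<And>t x. t \<in> {0..T} \<Longrightarrow> 0 \<le> x \<Longrightarrow> \<bar>u t x - u 0 x\<bar> \<le> D * exp (- x)"
    using exp_decay_improved[OF \<beta>(1), of C] by blast
  have "\<forall>\<^sub>F x in at_top. \<forall>t\<in>{0..T}. \<bar>u t x\<bar> \<le> (D + c1) * exp (- x)"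
    using eventually_ge_at_top[of "max 0 X"]
  proof eventually_elim
    case (elim x)
    have "\<bar>u t x\<bar> \<le> (D + c1) * exp (- x)" if t: "t \<in> {0..T}" for t
    proof -
      have "\<bar>u t x - u 0 x\<bar> \<le> D * exp (- x)" "\<bar>u 0 x\<bar> \<le> c1 * exp (- x)"
        using D[OF t, of x] X[of x] elim by auto
      then show ?thesis unfolding distrib_right by linarith
    qed
    then show ?case by blast
  qed
  then show ?thesis by blast
qed

end

section \<open>Strong solutions are classical\<close>

lemma eventually_bounded_on_compact:
  fixes P :: "'a::metric_space \<Rightarrow> real \<Rightarrow> bool"
  assumes K: "compact K" and mono: "\<And>t B B'. P t B \<Longrightarrow> B \<le> B' \<Longrightarrow> P t B'"
    and loc: "\<And>t. t \<in> K \<Longrightarrow> \<exists>B. P t B \<and> (\<forall>\<^sub>F \<tau> in at t within K. P \<tau> B)"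
  shows "\<exists>M. \<forall>t\<in>K. P t M"
proof (rule ccontr)
  assume "\<not> ?thesis"
  then have "\<forall>n. \<exists>t\<in>K. \<not> P t (real n)" by blast
  then obtain t where t: "\<And>n. t n \<in> K" "\<And>n. \<not> P (t n) (real n)" by metis
  then obtain l r where l: "l \<in> K" "strict_mono (r :: nat \<Rightarrow> nat)" "(t \<circ> r) \<longlonglongrightarrow> l"
    using K unfolding compact_def by metis
  \<comment> \<open>The bounds 0, 1, 2, ... fail at the points \<open>t n\<close>; near the limit
    \<open>l\<close> of a subsequence the local bound \<open>B\<close> holds, and monotonicity
    contradicts the failure once the index exceeds \<open>B\<close>.\<close>
  obtain B where B: "P l B" "\<forall>\<^sub>F \<tau> in at l within K. P \<tau> B" using loc[OF l(1)] by blast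
  then have "\<forall>\<^sub>F \<tau> in nhds l. \<tau> \<in> K \<longrightarrow> P \<tau> B"
    unfolding eventually_at_filter by (elim eventually_mono) auto
  then have "\<forall>\<^sub>F n in sequentially. (t \<circ> r) n \<in> K \<longrightarrow> P ((t \<circ> r) n) B"
    using l(3) unfolding filterlim_iff by blast
  then have "\<forall>\<^sub>F n in sequentially. P (t (r n)) B"
    by eventually_elim (simp add: t)
  moreover obtain N :: nat where "B \<le> real N" using real_arch_simple by blast
  moreover have "\<forall>\<^sub>F n in sequentially. N \<le> n" by (rule eventually_ge_at_top)
  ultimately have "\<forall>\<^sub>F n in sequentially. P (t (r n)) B \<and> N \<le> n" by (intro eventually_conj)
  then obtain n where n: "P (t (r n)) B" "N \<le> n"
    using eventually_happens by force
  have "real N \<le> real (r n)" using n(2) seq_suble[OF l(2), of n] by simp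
  then have "P (t (r n)) (real (r n))" using \<open>B \<le> real N\<close> by (intro mono[OF n(1)]) simp
  then show False using t(2) by blast
qed

text \<open>A nearby point is reached by changing the time at fixed \<open>y\<close>, which is
  uniform in \<open>y\<close>, and then moving in space at the fixed time \<open>t\<close>.\<close>

lemma continuous_on_product_uniform:
  fixes a :: "real \<Rightarrow> real \<Rightarrow> real"
  assumes cont: "\<And>t. t \<in> I \<Longrightarrow> continuous_on UNIV (a t)"
    and unif: "\<And>t e. t \<in> I \<Longrightarrow> 0 < e \<Longrightarrow> \<forall>\<^sub>F \<tau> in at t within I. \<forall>x. \<bar>a \<tau> x - a t x\<bar> < e"
  shows "continuous_on (I \<times> UNIV) (\<lambda>(t, x). a t x)"
  unfolding continuous_on_iff
proof (intro ballI allI impI)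
  fix z :: "real \<times> real" and e :: real assume z: "z \<in> I \<times> UNIV" and e: "0 < e"
  obtain t x where tx: "z = (t, x)" "t \<in> I" using z by auto
  obtain d1 where d1: "0 < d1" "\<And>\<tau>. \<tau> \<in> I \<Longrightarrow> \<tau> \<noteq> t \<Longrightarrow> dist \<tau> t < d1 \<Longrightarrow> \<forall>x. \<bar>a \<tau> x - a t x\<bar> < e / 2"
    using unif[OF tx(2), of "e / 2"] e unfolding eventually_at by auto
  obtain d2 where d2: "0 < d2" "\<And>y. dist y x < d2 \<Longrightarrow> dist (a t y) (a t x) < e / 2"
    using cont[OF tx(2)] e unfolding continuous_on_iff by (metis UNIV_I half_gt_zero)
  have "dist (a \<tau> y) (a t x) < e" if "\<tau> \<in> I" "dist (\<tau>, y) (t, x) < min d1 d2" for \<tau> y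
  proof -
    have "dist \<tau> t < d1" "dist y x < d2"
      using that(2) dist_fst_le[of "(\<tau>, y)" "(t, x)"] dist_snd_le[of "(\<tau>, y)" "(t, x)"] by auto
    then have "\<bar>a \<tau> y - a t y\<bar> < e / 2" "dist (a t y) (a t x) < e / 2"
      using d1(2)[OF that(1)] d2(2) e by (cases "\<tau> = t"; simp)+
    then show ?thesis unfolding dist_real_def by linarith
  qed
  then show "\<exists>d>0. \<forall>x'\<in>I \<times> UNIV. dist x' z < d \<longrightarrow> dist (case x' of (t, x) \<Rightarrow> a t x) (case z of (t, x) \<Rightarrow> a t x) < e"
    unfolding tx(1) using d1(1) d2(1) by (intro exI[of _ "min d1 d2"]) auto
qed

text \<open>Stated for a functional \<open>D\<close> so that it serves both for the identity and for
  \<open>deriv\<close>. Additivity is an assumption because \<open>deriv\<close> is additive only on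
  differentiable functions.\<close>

lemma continuous_into_Hs_uniform:
  fixes D :: "(real \<Rightarrow> real) \<Rightarrow> real \<Rightarrow> real"
  assumes u: "continuous_into_Hs s I u" "\<And>t. t \<in> I \<Longrightarrow> continuous_on UNIV (u t)"
    and D: "\<And>f x. f \<in> Hs s \<Longrightarrow> continuous_on UNIV f \<Longrightarrow> \<bar>D f x\<bar> \<le> C * Hs_norm s f"
    and lin: "\<And>t \<tau> x. t \<in> I \<Longrightarrow> \<tau> \<in> I \<Longrightarrow> D (\<lambda>x. u \<tau> x - u t x) x = D (u \<tau>) x - D (u t) x"
    and t: "t \<in> I" and e: "0 < e"
  shows "\<forall>\<^sub>F \<tau> in at t within I. \<forall>x. \<bar>D (u \<tau>) x - D (u t) x\<bar> < e"
proof -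
  have "((\<lambda>\<tau>. C * Hs_norm s (\<lambda>x. u \<tau> x - u t x)) \<longlongrightarrow> C * 0) (at t within I)"
    using u t by (intro tendsto_mult tendsto_const) (auto simp: continuous_into_Hs_def)
  then have "\<forall>\<^sub>F \<tau> in at t within I. C * Hs_norm s (\<lambda>x. u \<tau> x - u t x) < e"
    using e by (intro order_tendstoD(2)) auto
  moreover have "\<forall>\<^sub>F \<tau> in at t within I. \<tau> \<in> I"
    by (simp add: eventually_at_filter)
  ultimately show ?thesis
  proof eventually_elim
    case (elim \<tau>)
    have "(\<lambda>x. 1 * u \<tau> x + (- 1) * u t x) \<in> Hs s"
      using u(1) t elim by (intro Hs_linear) (auto simp: continuous_into_Hs_def)
    then have "(\<lambda>x. u \<tau> x - u t x) \<in> Hs s" by simp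
    moreover have "continuous_on UNIV (\<lambda>x. u \<tau> x - u t x)"
      using u(2) t elim by (intro continuous_intros) auto
    ultimately have "\<bar>D (\<lambda>x. u \<tau> x - u t x) x\<bar> < e" for x
      by (rule order_le_less_trans[OF D elim(1)])
    then show ?case
      using lin[OF t elim(2)] by simp
  qed
qed

text \<open>The bound on \<open>D\<close> turns convergence of the difference quotients in norm into
  convergence at a point. With \<open>D = deriv\<close> it also interchanges the time and space
  derivatives.\<close>

lemma has_Hs_derivative_pointwise:
  fixes D :: "(real \<Rightarrow> real) \<Rightarrow> real \<Rightarrow> real"
  assumes u: "has_Hs_derivative s I u v t" "\<And>t. t \<in> I \<Longrightarrow> continuous_on UNIV (u t)" "continuous_on UNIV v"
    and D: "\<And>f x. f \<in> Hs s \<Longrightarrow> continuous_on UNIV f \<Longrightarrow> \<bar>D f x\<bar> \<le> C * Hs_norm s f"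
    and lin: "\<And>\<tau> x. \<tau> \<in> I \<Longrightarrow> D (\<lambda>x. (u \<tau> x - u t x) / (\<tau> - t) - v x) x = (D (u \<tau>) x - D (u t) x) / (\<tau> - t) - D v x"
    and t: "t \<in> I"
  shows "((\<lambda>\<tau>. D (u \<tau>) x) has_real_derivative D v x) (at t within I)"
proof -
  have "((\<lambda>\<tau>. (D (u \<tau>) x - D (u t) x) / (\<tau> - t) - D v x) \<longlongrightarrow> 0) (at t within I)"
  proof (rule Lim_null_comparison)
    have "((\<lambda>\<tau>. C * Hs_norm s (\<lambda>x. (u \<tau> x - u t x) / (\<tau> - t) - v x)) \<longlongrightarrow> C * 0) (at t within I)"
      using u(1) by (intro tendsto_mult tendsto_const) (auto simp: has_Hs_derivative_def)
    then show "((\<lambda>\<tau>. C * Hs_norm s (\<lambda>x. (u \<tau> x - u t x) / (\<tau> - t) - v x)) \<longlongrightarrow> 0) (at t within I)"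
      by simp
    have "\<forall>\<^sub>F \<tau> in at t within I. \<tau> \<in> I \<and> \<tau> \<noteq> t"
      by (simp add: eventually_at_filter)
    then show "\<forall>\<^sub>F \<tau> in at t within I. norm ((D (u \<tau>) x - D (u t) x) / (\<tau> - t) - D v x)
       \<le> C * Hs_norm s (\<lambda>x. (u \<tau> x - u t x) / (\<tau> - t) - v x)"
    proof eventually_elim
      case (elim \<tau>)
      have "(\<lambda>x. inverse (\<tau> - t) * (1 * u \<tau> x + (- 1) * u t x) + (- 1) * v x) \<in> Hs s"
        using u(1) t elim by (intro Hs_linear) (auto simp: has_Hs_derivative_def)
      then have "(\<lambda>x. (u \<tau> x - u t x) / (\<tau> - t) - v x) \<in> Hs s"
        by (simp add: divide_inverse mult.commute)
      moreover have "continuous_on UNIV (\<lambda>x. (u \<tau> x - u t x) / (\<tau> - t) - v x)"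
        using u(2,3) t elim by (intro continuous_intros) auto
      ultimately have "\<bar>D (\<lambda>x. (u \<tau> x - u t x) / (\<tau> - t) - v x) x\<bar> \<le> C * Hs_norm s (\<lambda>x. (u \<tau> x - u t x) / (\<tau> - t) - v x)"
        by (rule D)
      then show ?case using lin[of \<tau> x] elim by simp
    qed
  qed
  then show ?thesis
    unfolding has_field_derivative_iff by (rule LIM_zero_cancel)
qed

text \<open>For s > 5/2 each \<open>u t\<close> has two classical space derivatives. As s - 1 > 3/2,
  convergence of the time difference quotients in \<open>Hs (s - 1)\<close> controls their first
  space derivative, so u_x is differentiable in time as well.\<close>

lemma strong_solution_smooth:
  assumes T: "T > 0" and s: "s > 5/2" and u: "strong_solution s T u"
  shows "\<exists>M. smooth_solution u (\<lambda>t. deriv (u t)) (\<lambda>t. deriv (deriv (u t))) T M"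
proof -
  define w where "w t = deriv (u t)" for t
  define v where "v t = deriv (w t)" for t
  let ?f = "\<lambda>t y. 2/3 * (u t y)^3 + u t y * (w t y)\<^sup>2" and ?g = "\<lambda>t y. (w t y)^3"
  have uH: "continuous_into_Hs s {0..T} u" and cont: "\<And>t. t \<in> {0..T} \<Longrightarrow> continuous_on UNIV (u t)"
    using u by (auto simp: strong_solution_def)
  obtain u' where u'H: "\<And>t. t \<in> {0..T} \<Longrightarrow> has_Hs_derivative (s - 1) {0..T} u (u' t) t"
    and u'_eq: "\<And>t x. t \<in> {0..T} \<Longrightarrow> u' t x + (u t x)\<^sup>2 * w t x + deriv (convolution G (?f t)) x
       + 1/3 * deriv (deriv (convolution G (?g t))) x = 0"
    using u unfolding strong_solution_def w_def by blast
  have inH: "u t \<in> Hs s" if "t \<in> {0..T}" for t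
    using uH that by (auto simp: continuous_into_Hs_def)
  have DERIV_u: "DERIV (u t) x :> w t x" if "t \<in> {0..T}" for t x
    unfolding w_def using s by (intro Hs_differentiable[OF _ inH[OF that] cont[OF that]]) simp
  have DERIV_w: "DERIV (w t) x :> v t x" if "t \<in> {0..T}" for t x
    unfolding v_def w_def by (rule Hs_deriv_differentiable[OF s inH[OF that] cont[OF that]])
  have contw: "continuous_on UNIV (w t)" if "t \<in> {0..T}" for t
    by (rule DERIV_continuous_on, rule DERIV_w[OF that])
  obtain C0 where C0: "0 \<le> C0" "\<And>f x. f \<in> Hs s \<Longrightarrow> continuous_on UNIV f \<Longrightarrow> \<bar>f x\<bar> \<le> C0 * Hs_norm s f"
    using Hs_sup_bound[of s] s by auto
  obtain C1 where C1: "0 \<le> C1" "\<And>f x. f \<in> Hs s \<Longrightarrow> continuous_on UNIV f \<Longrightarrow> \<bar>deriv f x\<bar> \<le> C1 * Hs_norm s f"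
    using Hs_deriv_sup_bound[of s] s by auto
  have unif_u: "\<forall>\<^sub>F \<tau> in at t within {0..T}. \<forall>x. \<bar>u \<tau> x - u t x\<bar> < e" if "t \<in> {0..T}" "0 < e" for t e
    by (rule continuous_into_Hs_uniform[where D = "\<lambda>f. f", OF uH cont C0(2) _ that]) auto
  have unif_w: "\<forall>\<^sub>F \<tau> in at t within {0..T}. \<forall>x. \<bar>w \<tau> x - w t x\<bar> < e" if "t \<in> {0..T}" "0 < e" for t e
    unfolding w_def
  proof (rule continuous_into_Hs_uniform[where D = deriv, OF uH cont C1(2) _ that])
    fix t \<tau> x assume t: "t \<in> {0..T}" "\<tau> \<in> {0..T}"
    have "DERIV (\<lambda>x. u \<tau> x - u t x) x :> w \<tau> x - w t x"
      by (intro DERIV_diff DERIV_u t)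
    then show "deriv (\<lambda>x. u \<tau> x - u t x) x = deriv (u \<tau>) x - deriv (u t) x"
      unfolding w_def by (rule DERIV_imp_deriv)
  qed
  \<comment> \<open>Uniform closeness of \<open>u\<close> and \<open>w\<close> at neighbouring times
    gives a local bound, and compactness of the time interval makes it global.\<close>
  have "\<exists>M. \<forall>t\<in>{0..T}. \<forall>x. \<bar>u t x\<bar> \<le> M \<and> \<bar>w t x\<bar> \<le> M"
  proof (rule eventually_bounded_on_compact)
    fix t assume t: "t \<in> {0..T}"
    define B where "B = C0 * Hs_norm s (u t) + C1 * Hs_norm s (u t)"
    have h: "\<bar>u t x\<bar> \<le> C0 * Hs_norm s (u t)" "\<bar>w t x\<bar> \<le> C1 * Hs_norm s (u t)" for x
      unfolding w_def by (rule C0 C1, rule inH[OF t], rule cont[OF t])+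
    have B: "\<bar>u t x\<bar> \<le> B \<and> \<bar>w t x\<bar> \<le> B" for x
      using h[of x] unfolding B_def by (intro conjI; linarith)
    have "\<forall>\<^sub>F \<tau> in at t within {0..T}. \<forall>x. \<bar>u \<tau> x\<bar> \<le> B + 1 \<and> \<bar>w \<tau> x\<bar> \<le> B + 1"
      using unif_u[OF t zero_less_one] unif_w[OF t zero_less_one]
    proof eventually_elim
      case (elim \<tau>)
      show ?case
      proof
        fix x
        have "\<bar>u \<tau> x - u t x\<bar> < 1" "\<bar>w \<tau> x - w t x\<bar> < 1" using elim by auto
        then show "\<bar>u \<tau> x\<bar> \<le> B + 1 \<and> \<bar>w \<tau> x\<bar> \<le> B + 1"
          using B[of x] by linarith
      qed
    qed
    moreover have "\<forall>x. \<bar>u t x\<bar> \<le> B + 1 \<and> \<bar>w t x\<bar> \<le> B + 1"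
    proof
      fix x
      show "\<bar>u t x\<bar> \<le> B + 1 \<and> \<bar>w t x\<bar> \<le> B + 1" using B[of x] by linarith
    qed
    ultimately show "\<exists>B. (\<forall>x. \<bar>u t x\<bar> \<le> B \<and> \<bar>w t x\<bar> \<le> B) \<and> (\<forall>\<^sub>F \<tau> in at t within {0..T}. \<forall>x. \<bar>u \<tau> x\<bar> \<le> B \<and> \<bar>w \<tau> x\<bar> \<le> B)"
      by blast
  next
    show "\<forall>x. \<bar>u t x\<bar> \<le> B' \<and> \<bar>w t x\<bar> \<le> B'" if "\<forall>x. \<bar>u t x\<bar> \<le> B \<and> \<bar>w t x\<bar> \<le> B" "B \<le> B'" for t B B'
      using that by (meson order_trans)
  qed simp
  then obtain M where M: "\<And>t x. t \<in> {0..T} \<Longrightarrow> \<bar>u t x\<bar> \<le> M" "\<And>t x. t \<in> {0..T} \<Longrightarrow> \<bar>w t x\<bar> \<le> M"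
    by blast
  let ?ut = "\<lambda>t x. - (((u t x)\<^sup>2 - (w t x)\<^sup>2) * w t x) - 2/3 * (w t x)^3
        - deriv (convolution G (?f t)) x - 1/3 * convolution G (?g t) x"
  let ?wt = "\<lambda>t x. - (((u t x)\<^sup>2 - (w t x)\<^sup>2) * v t x) - u t x * (w t x)\<^sup>2 + 2/3 * (u t x)^3
        - convolution G (?f t) x - 1/3 * deriv (convolution G (?g t)) x"
  have src: "continuous_on UNIV (?f t)" "continuous_on UNIV (?g t)"
      "\<And>x. \<bar>?f t x\<bar> \<le> 5/3 * M\<^sup>2 * M" "\<And>x. \<bar>?g t x\<bar> \<le> M\<^sup>2 * M" if t: "t \<in> {0..T}" for t
    using cubic_le[OF M(1)[OF t] M(2)[OF t] M(1)[OF t] M(2)[OF t]] cont[OF t] contw[OF t]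
    by (auto intro!: continuous_intros)
  have u'_ut: "u' t x = ?ut t x" if t: "t \<in> {0..T}" for t x
  proof -
    have "deriv (deriv (convolution G (?g t))) x = convolution G (?g t) x - ?g t x"
      using src[OF t] by (intro DERIV_imp_deriv DERIV_deriv_convolution_G)
    then show ?thesis
      using u'_eq[OF t, of x] by (simp add: field_simps power2_eq_square power3_eq_cube)
  qed
  \<comment> \<open>Membership in \<open>Hs (s - 1)\<close> leaves \<open>u' t\<close> free on null
    sets; the pointwise equation identifies it with an explicit differentiable function, which the
    pointwise derivative lemma requires.\<close>
  have DERIV_u': "DERIV (u' t) x :> ?wt t x" if t: "t \<in> {0..T}" for t x
  proof -
    note P = DERIV_deriv_convolution_G[OF src(1,3)[OF t]] and Q = DERIV_convolution_G[OF src(2,4)[OF t]]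
    have "u' t = ?ut t" using u'_ut[OF t] by (rule ext)
    moreover have "DERIV (?ut t) x :> ?wt t x"
      by (rule derivative_eq_intros DERIV_u[OF t] DERIV_w[OF t] P Q refl)+
        (simp add: field_simps power2_eq_square power3_eq_cube)
    ultimately show ?thesis by simp
  qed
  have contu': "continuous_on UNIV (u' t)" if "t \<in> {0..T}" for t
    by (rule DERIV_continuous_on, rule DERIV_u'[OF that])
  obtain K0 where K0: "\<And>f x. f \<in> Hs (s - 1) \<Longrightarrow> continuous_on UNIV f \<Longrightarrow> \<bar>f x\<bar> \<le> K0 * Hs_norm (s - 1) f"
    using Hs_sup_bound[of "s - 1"] s by auto
  obtain K1 where K1: "\<And>f x. f \<in> Hs (s - 1) \<Longrightarrow> continuous_on UNIV f \<Longrightarrow> \<bar>deriv f x\<bar> \<le> K1 * Hs_norm (s - 1) f"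
    using Hs_deriv_sup_bound[of "s - 1"] s by auto
  have ut: "((\<lambda>\<tau>. u \<tau> x) has_real_derivative ?ut t x) (at t within {0..T})" if t: "t \<in> {0..T}" for t x
    unfolding u'_ut[OF t, symmetric]
    by (rule has_Hs_derivative_pointwise[where D = "\<lambda>f. f", OF u'H[OF t] cont contu'[OF t] K0 _ t]) auto
  have wt: "((\<lambda>\<tau>. w \<tau> x) has_real_derivative ?wt t x) (at t within {0..T})" if t: "t \<in> {0..T}" for t x
  proof -
    have "((\<lambda>\<tau>. deriv (u \<tau>) x) has_real_derivative deriv (u' t) x) (at t within {0..T})"
    proof (rule has_Hs_derivative_pointwise[where D = deriv, OF u'H[OF t] cont contu'[OF t] K1 _ t])
      fix \<tau> x assume \<tau>: "\<tau> \<in> {0..T}"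
      have "DERIV (\<lambda>x. (u \<tau> x - u t x) / (\<tau> - t) - u' t x) x :> (w \<tau> x - w t x) / (\<tau> - t) - ?wt t x"
        by (intro DERIV_diff DERIV_cdivide DERIV_u DERIV_u' t \<tau>)
      moreover have "deriv (u' t) x = ?wt t x" by (rule DERIV_imp_deriv[OF DERIV_u'[OF t]])
      ultimately show "deriv (\<lambda>x. (u \<tau> x - u t x) / (\<tau> - t) - u' t x) x = (deriv (u \<tau>) x - deriv (u t) x) / (\<tau> - t) - deriv (u' t) x"
        unfolding w_def[symmetric] by (simp only: DERIV_imp_deriv)
    qed
    then show ?thesis
      unfolding w_def[symmetric] DERIV_imp_deriv[OF DERIV_u'[OF t]] .
  qed
  have "smooth_solution u w v T M"
  proof
    show "continuous_on ({0..T} \<times> UNIV) (\<lambda>(t, x). u t x)"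
      by (rule continuous_on_product_uniform[OF cont unif_u])
    show "continuous_on ({0..T} \<times> UNIV) (\<lambda>(t, x). w t x)"
      by (rule continuous_on_product_uniform[OF contw unif_w])
  qed (fact T DERIV_u DERIV_w M ut wt)+
  then show ?thesis
    unfolding v_def[abs_def] w_def[abs_def] by blast
qed

theorem theorem7p2:
  fixes u :: "real \<Rightarrow> real \<Rightarrow> real" and s T \<beta> :: real
  assumes "T > 0" and "s > 5/2"
    and "strong_solution s T u"
    and "1/3 < \<beta>" and "\<beta> < 1"
    and "u 0 \<in> O[at_top](\<lambda>x. exp (- x))"
    and "deriv (u 0) \<in> O[at_top](\<lambda>x. exp (- \<beta> * x))"
  shows "\<exists>C. \<forall>\<^sub>F x in at_top. \<forall>t\<in>{0..T}. \<bar>u t x\<bar> \<le> C * exp (- x)"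
proof -
  obtain M where "smooth_solution u (\<lambda>t. deriv (u t)) (\<lambda>t. deriv (deriv (u t))) T M"
    using strong_solution_smooth assms(1-3) by blast
  then show ?thesis
    using assms(4-7) by (rule smooth_solution.persistence)
qed

end
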